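(* Let $(G,p)$ be a generic framework on the unit cylinder $\mathcal{Y}$ which has a maximum rank equilibrium stress $(\omega,\lambda)$. Then $(G,p)$ is globally rigid on $\mathcal{Y}$.
   Context: All graphs finite and simple. Let $\mathcal{Y}=\{(x,y,z):x^2+y^2=1\}$; a framework $(G,p)$ on $\mathcal{Y}$ with $V=\{v_1,\dots,v_n\}$ is a map $p:V\to\mathcal{Y}$, generic if its coordinates generate a field of transcendence degree $2n$ over $\mathbb{Q}$. Frameworks are equivalent if corresponding edge lengths agree and congruent if all pairwise vertex distances agree; $(G,p)$ is globally rigid on $\mathcal{Y}$ if every framework on $\mathcal{Y}$ equivalent to it is congruent to it. Write $p(v_i)=(x_i,y_i,z_i)$, $\bar p(v_i)=(x_i,y_i,0)$. An equilibrium stress is $(\omega,\lambda)$, $\omega:E\to\mathbb{R}$, $\lambda:V\to\mathbb{R}$, with $\sum_j\omega_{ij}(p(v_i)-p(v_j))+\lambda_i\bar p(v_i)=0$ for all $i$ ($\omega_{ij}=\omega_e$ if $e=v_iv_j\in E$, else $0$). $\Omega$ is the $n\times n$ matrix with off-diagonal entries $-\omega_{ij}$ and diagonal entries $\sum_j\omega_{ij}$, $\Lambda=\mathrm{diag}(\lambda_i)$, and $\Omega_{\mathrm{cyl}}(\omega,\lambda)=\mathrm{diag}(\Omega+\Lambda,\Omega+\Lambda,\Omega)$; the stress has maximum rank if $\operatorname{rank}\Omega_{\mathrm{cyl}}(\omega,\lambda)=3n-6$.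
   Formalization: The graph with two vertices and no edges is excluded: there 3n-6=0, so the zero stress has maximum rank, yet the framework is not globally rigid. *)

theory Defs
  imports "HOL-Analysis.Analysis" "HOL-Library.Poly_Mapping"
begin

section \<open>Transcendence degree over the rationals\<close>

definition is_subfield :: "real set \<Rightarrow> bool" where
  "is_subfield F \<longleftrightarrow> 0 \<in> F \<and> 1 \<in> F \<and>
     (\<forall>x\<in>F. \<forall>y\<in>F. x + y \<in> F \<and> x - y \<in> F \<and> x * y \<in> F) \<and>
     (\<forall>x\<in>F. inverse x \<in> F)"

text \<open>Every subfield of the reals contains the rationals, so this is the extension
  of the rationals generated by \<open>S\<close>.\<close>
definition generated_field :: "real set \<Rightarrow> real set" where
  "generated_field S = is_subfield hull S"

text \<open>Polynomials with rational coefficients whose indeterminates are labelled by real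
  numbers (a monomial is a finitely supported exponent function); evaluation substitutes
  for each indeterminate its own label.\<close>
definition eval_at_labels :: "((real \<Rightarrow>\<^sub>0 nat) \<Rightarrow>\<^sub>0 rat) \<Rightarrow> real" where
  "eval_at_labels P =
     (\<Sum>m\<in>Poly_Mapping.keys P. of_rat (Poly_Mapping.lookup P m) *
        (\<Prod>a\<in>Poly_Mapping.keys m. a ^ Poly_Mapping.lookup m a))"

definition algebraically_independent :: "real set \<Rightarrow> bool" where
  "algebraically_independent A \<longleftrightarrow>
     (\<forall>P. P \<noteq> 0 \<and> (\<forall>m\<in>Poly_Mapping.keys P. Poly_Mapping.keys m \<subseteq> A)
        \<longrightarrow> eval_at_labels P \<noteq> 0)"

definition transcendence_basis :: "real set \<Rightarrow> real set \<Rightarrow> bool" where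
  "transcendence_basis B F \<longleftrightarrow> B \<subseteq> F \<and> algebraically_independent B \<and>
     (\<forall>B'. B \<subseteq> B' \<and> B' \<subseteq> F \<and> algebraically_independent B' \<longrightarrow> B' = B)"

text \<open>All transcendence bases of \<open>F\<close> have the same cardinality, so at most one \<open>d\<close>
  satisfies this.\<close>
definition has_transcendence_degree :: "real set \<Rightarrow> nat \<Rightarrow> bool" where
  "has_transcendence_degree F d \<longleftrightarrow> (\<exists>B. transcendence_basis B F \<and> finite B \<and> card B = d)"


section \<open>Frameworks on the unit cylinder\<close>

text \<open>The vertex set is the universe of a finite type \<open>'v\<close>, so the number of vertices
  is \<open>CARD('v)\<close>; a graph is given by its set of edges.\<close>
definition simple_graph :: "'v set set \<Rightarrow> bool" where
  "simple_graph E \<longleftrightarrow> (\<forall>e\<in>E. card e = 2)"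

definition unit_cylinder :: "(real^3) set" where
  "unit_cylinder = {a. (a $ 1)\<^sup>2 + (a $ 2)\<^sup>2 = 1}"

definition on_cylinder :: "('v \<Rightarrow> real^3) \<Rightarrow> bool" where
  "on_cylinder p \<longleftrightarrow> (\<forall>v. p v \<in> unit_cylinder)"

definition generic_on_cylinder :: "('v::finite \<Rightarrow> real^3) \<Rightarrow> bool" where
  "generic_on_cylinder p \<longleftrightarrow> on_cylinder p \<and>
     has_transcendence_degree (generated_field {p v $ k | v k. True}) (2 * CARD('v))"

definition equivalent_frameworks ::
    "'v set set \<Rightarrow> ('v \<Rightarrow> real^3) \<Rightarrow> ('v \<Rightarrow> real^3) \<Rightarrow> bool" where
  "equivalent_frameworks E p q \<longleftrightarrow>
     (\<forall>u v. {u, v} \<in> E \<longrightarrow> dist (p u) (p v) = dist (q u) (q v))"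

definition congruent_frameworks :: "('v \<Rightarrow> real^3) \<Rightarrow> ('v \<Rightarrow> real^3) \<Rightarrow> bool" where
  "congruent_frameworks p q \<longleftrightarrow> (\<forall>u v. dist (p u) (p v) = dist (q u) (q v))"

definition globally_rigid_on_cylinder :: "'v set set \<Rightarrow> ('v \<Rightarrow> real^3) \<Rightarrow> bool" where
  "globally_rigid_on_cylinder E p \<longleftrightarrow>
     (\<forall>q. on_cylinder q \<and> equivalent_frameworks E p q \<longrightarrow> congruent_frameworks p q)"


section \<open>Equilibrium stresses\<close>

text \<open>A stress \<open>\<omega>\<close> is a total function on vertex sets, but only its values on \<open>E\<close> are used.\<close>
definition stress_coeff :: "'v set set \<Rightarrow> ('v set \<Rightarrow> real) \<Rightarrow> 'v \<Rightarrow> 'v \<Rightarrow> real" where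
  "stress_coeff E \<omega> i j = (if {i, j} \<in> E then \<omega> {i, j} else 0)"

definition horizontal :: "real^3 \<Rightarrow> real^3" where
  "horizontal a = vector [a $ 1, a $ 2, 0]"

definition equilibrium_stress ::
    "'v::finite set set \<Rightarrow> ('v \<Rightarrow> real^3) \<Rightarrow> ('v set \<Rightarrow> real) \<Rightarrow> ('v \<Rightarrow> real) \<Rightarrow> bool" where
  "equilibrium_stress E p \<omega> l \<longleftrightarrow>
     (\<forall>i. (\<Sum>j\<in>UNIV. stress_coeff E \<omega> i j *\<^sub>R (p i - p j)) + l i *\<^sub>R horizontal (p i) = 0)"

definition stress_matrix :: "'v::finite set set \<Rightarrow> ('v set \<Rightarrow> real) \<Rightarrow> real^'v^'v" where
  "stress_matrix E \<omega> =
     (\<chi> i j. if i = j then (\<Sum>k\<in>UNIV. stress_coeff E \<omega> i k) else - stress_coeff E \<omega> i j)"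

definition diag_matrix :: "('v::finite \<Rightarrow> real) \<Rightarrow> real^'v^'v" where
  "diag_matrix l = (\<chi> i j. if i = j then l i else 0)"

definition block_diag3 ::
    "real^'v^'v \<Rightarrow> real^'v^'v \<Rightarrow> real^'v^'v \<Rightarrow> real^('v + 'v + 'v)^('v::finite + 'v + 'v)" where
  "block_diag3 A B C = (\<chi> r s.
     (case (r, s) of
        (Inl i, Inl j) \<Rightarrow> A $ i $ j
      | (Inr (Inl i), Inr (Inl j)) \<Rightarrow> B $ i $ j
      | (Inr (Inr i), Inr (Inr j)) \<Rightarrow> C $ i $ j
      | _ \<Rightarrow> 0))"

definition cylinder_stress_matrix ::
    "'v::finite set set \<Rightarrow> ('v set \<Rightarrow> real) \<Rightarrow> ('v \<Rightarrow> real) \<Rightarrow> real^('v + 'v + 'v)^('v + 'v + 'v)" where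
  "cylinder_stress_matrix E \<omega> l =
     block_diag3 (stress_matrix E \<omega> + diag_matrix l)
                 (stress_matrix E \<omega> + diag_matrix l)
                 (stress_matrix E \<omega>)"

text \<open>The equation is over the integers: for a single vertex the required rank is negative,
  and the condition fails.\<close>
definition maximum_rank_stress ::
    "'v::finite set set \<Rightarrow> ('v set \<Rightarrow> real) \<Rightarrow> ('v \<Rightarrow> real) \<Rightarrow> bool" where
  "maximum_rank_stress E \<omega> l \<longleftrightarrow>
     int (rank (cylinder_stress_matrix E \<omega> l)) = 3 * int CARD('v) - 6"

end

theory Submission
  imports Defs
begin

text \<open>
  Because \<open>p\<close> is generic, every tangent vector at \<open>p\<close> to the configuration space has the form
  \<open>D p\<close> for a derivation \<open>D\<close> of the reals. Applying \<open>D\<close> to the common squared edge lengths of \<open>p\<close>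
  and \<open>q\<close> shows that the range of the rigidity matrix of \<open>p\<close> is contained in that of \<open>q\<close>; genericity
  also makes the rank at \<open>p\<close> maximal, so the ranges agree and the edge weights \<open>\<omega>\<close> balance \<open>q\<close>
  tangentially. Maximality of the rank then gives \<open>z' = a + b z\<close> for the heights of \<open>q\<close>.

  The radial weights of \<open>q\<close> agree with \<open>\<lambda>\<close> once \<open>b\<^sup>2 = 1\<close>. Otherwise the motions of \<open>p\<close> that keep \<open>b\<close>
  and the angular differences of \<open>q\<close> fixed rescale to flexes of \<open>p\<close>, and a commutator argument
  shows that flexes of \<open>p\<close> change the heights by affine functions of the heights, which leaves
  too few of them. With the same \<open>\<lambda>\<close>, the horizontal coordinates of \<open>q\<close> are a linear image of those
  of \<open>p\<close> under a map that preserves the norms of three pairwise independent vectors, hence is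
  orthogonal.
\<close>

section \<open>Derivations of the reals\<close>

text \<open>Stated over any commutative ring, because it serves both for the reals and, in
  \<open>derivation_fps_deriv\<close>, for formal power series.\<close>

definition derivation :: "('a::comm_ring_1 \<Rightarrow> 'a) \<Rightarrow> bool" where
  "derivation D \<longleftrightarrow> (\<forall>x y. D (x + y) = D x + D y) \<and> (\<forall>x y. D (x * y) = D x * y + x * D y)"

lemma derivation_add: "derivation D \<Longrightarrow> D (x + y) = D x + D y"
  and derivation_mult: "derivation D \<Longrightarrow> D (x * y) = D x * y + x * D y"
  by (simp_all add: derivation_def)

lemma derivation_0: "derivation D \<Longrightarrow> D 0 = 0"
  using derivation_add[of D 0 0] by simp

lemma derivation_1: "derivation D \<Longrightarrow> D 1 = 0"
  using derivation_mult[of D 1 1] by simp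

lemma derivation_minus: "derivation D \<Longrightarrow> D (- x) = - D x"
  using derivation_add[of D x "- x"] derivation_0[of D] by (simp add: eq_neg_iff_add_eq_0 add.commute)

lemma derivation_diff: "derivation D \<Longrightarrow> D (x - y) = D x - D y"
  using derivation_add[of D x "- y"] derivation_minus[of D y] by simp

lemma derivation_of_nat: "derivation D \<Longrightarrow> D (of_nat n) = 0"
  by (induction n) (simp_all add: derivation_0 derivation_1 derivation_add)

lemma derivation_of_int: "derivation D \<Longrightarrow> D (of_int n) = 0"
  by (cases n rule: int_cases2) (simp_all add: derivation_of_nat derivation_minus)

lemma derivation_numeral: "derivation D \<Longrightarrow> D (numeral n) = 0"
  using derivation_of_nat[of D "numeral n"] by simp

lemma derivation_sum: "derivation D \<Longrightarrow> D (sum f S) = (\<Sum>i\<in>S. D (f i))"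
  by (induction S rule: infinite_finite_induct) (simp_all add: derivation_0 derivation_add)

lemma derivation_power2: "derivation D \<Longrightarrow> D (x\<^sup>2) = 2 * x * D x"
  by (simp add: power2_eq_square derivation_mult algebra_simps)

lemmas derivation_simps =
  derivation_add derivation_mult derivation_0 derivation_1 derivation_minus derivation_diff
  derivation_of_int derivation_numeral derivation_sum derivation_power2

lemma derivation_linear_combination:
  assumes "\<And>i. i \<in> S \<Longrightarrow> derivation (D i)"
  shows "derivation (\<lambda>x. \<Sum>i\<in>S. r i * D i x)"
  using assms
  by (simp add: derivation_def sum.distrib distrib_left sum_distrib_left sum_distrib_right mult_ac)

lemma derivation_commutator:
  assumes "derivation D" "derivation D'"
  shows "derivation (\<lambda>x. D (D' x) - D' (D x))"
  using assms by (simp add: derivation_def algebra_simps)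

lemma derivation_inverse:
  fixes D :: "'a::field \<Rightarrow> 'a"
  assumes "derivation D" "D x = 0"
  shows "D (inverse x) = 0"
proof (cases "x = 0")
  case False
  then have "0 = D (x * inverse x)"
    using assms by (simp add: derivation_1)
  also have "\<dots> = x * D (inverse x)"
    using assms by (simp add: derivation_mult)
  finally show ?thesis using False by simp
qed (use assms in simp)

text \<open>The zeros of a derivation form a subfield.\<close>

lemma derivation_zero_on_generated_field:
  assumes D: "derivation D" and S: "\<And>x. x \<in> S \<Longrightarrow> D x = 0" and b: "b \<in> generated_field S"
  shows "D b = 0"
proof -
  have "is_subfield {x. D x = 0}"
    using D by (auto simp: is_subfield_def derivation_simps derivation_inverse)
  then have "generated_field S \<subseteq> {x. D x = 0}"
    unfolding generated_field_def using S by (intro hull_minimal) auto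
  then show ?thesis using b by blast
qed

section \<open>Dual numbers and the extension of partial derivations\<close>

datatype dual = Dual (dre: real) (dep: real)

text \<open>\<open>Dual a b\<close> is a + b \<epsilon> with \<epsilon>^2 = 0; a map D is a
  derivation exactly when x + \<epsilon> D(x) is additive and multiplicative in x.\<close>

instantiation dual :: comm_ring_1
begin

definition "0 = Dual 0 0"
definition "1 = Dual 1 0"
definition "x + y = Dual (dre x + dre y) (dep x + dep y)"
definition "x - y = Dual (dre x - dre y) (dep x - dep y)"
definition "- x = Dual (- dre x) (- dep x)"
definition "x * y = Dual (dre x * dre y) (dep x * dre y + dre x * dep y)"

instance
  by standard
    (simp_all add: zero_dual_def one_dual_def plus_dual_def minus_dual_def uminus_dual_def
      times_dual_def algebra_simps)

end

lemma dual_simps [simp]: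
  "dre 0 = 0" "dep 0 = 0" "dre 1 = 1" "dep 1 = 0"
  "dre (x + y) = dre x + dre y" "dep (x + y) = dep x + dep y"
  "dre (x - y) = dre x - dre y" "dep (x - y) = dep x - dep y"
  "dre (x * y) = dre x * dre y" "dep (x * y) = dep x * dre y + dre x * dep y"
  by (simp_all add: zero_dual_def one_dual_def plus_dual_def minus_dual_def times_dual_def)

lemma dual_eq_iff: "x = y \<longleftrightarrow> dre x = dre y \<and> dep x = dep y" for x y :: dual
  by (metis dual.collapse)

lemma dre_of_nat [simp]: "dre (of_nat n) = of_nat n"
  by (induction n) simp_all

lemma dre_power [simp]: "dre (x ^ n) = dre x ^ n"
  by (induction n) simp_all

lemma dre_sum: "dre (sum f S) = (\<Sum>i\<in>S. dre (f i))"
  by (induction S rule: infinite_finite_induct) simp_all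

lemma dre_prod: "dre (prod f S) = (\<Prod>i\<in>S. dre (f i))"
  by (induction S rule: infinite_finite_induct) simp_all

text \<open>The graph of a partial derivation, written as a set of dual numbers \<open>x + \<epsilon> D(x)\<close>.\<close>
definition derivation_graph :: "dual set \<Rightarrow> bool" where
  "derivation_graph G \<longleftrightarrow> 1 \<in> G \<and> (\<forall>x\<in>G. \<forall>y\<in>G. x + y \<in> G \<and> x - y \<in> G \<and> x * y \<in> G)
     \<and> (\<forall>x\<in>G. dre x = 0 \<longrightarrow> x = 0)"

lemma derivation_graphD:
  assumes "derivation_graph G"
  shows "1 \<in> G" "0 \<in> G"
    and "\<lbrakk>x \<in> G; y \<in> G\<rbrakk> \<Longrightarrow> x + y \<in> G"
    and "\<lbrakk>x \<in> G; y \<in> G\<rbrakk> \<Longrightarrow> x - y \<in> G"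
    and "\<lbrakk>x \<in> G; y \<in> G\<rbrakk> \<Longrightarrow> x * y \<in> G"
    and "\<lbrakk>x \<in> G; dre x = 0\<rbrakk> \<Longrightarrow> x = 0"
proof -
  show "1 \<in> G" using assms by (simp add: derivation_graph_def)
  moreover have "1 - 1 \<in> G" using assms by (meson derivation_graph_def)
  ultimately show "0 \<in> G" by simp
qed (use assms in \<open>auto simp: derivation_graph_def\<close>)

text \<open>The library's \<open>pderiv\<close> requires the coefficients to have no zero divisors.\<close>
definition dual_pderiv :: "dual poly \<Rightarrow> dual poly" where
  "dual_pderiv f = (\<Sum>i\<le>degree f. monom (of_nat (Suc i) * coeff f (Suc i)) i)"

lemma coeff_dual_pderiv: "coeff (dual_pderiv f) n = of_nat (Suc n) * coeff f (Suc n)"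
proof -
  have "coeff (dual_pderiv f) n =
      (\<Sum>i\<le>degree f. if i = n then of_nat (Suc i) * coeff f (Suc i) else 0)"
    unfolding dual_pderiv_def coeff_sum coeff_monom ..
  also have "\<dots> = of_nat (Suc n) * coeff f (Suc n)"
    by (simp add: coeff_eq_0 del: of_nat_Suc)
  finally show ?thesis .
qed

lemma map_poly_dual_pderiv: "map_poly dre (dual_pderiv f) = pderiv (map_poly dre f)"
  by (intro poly_eqI) (simp add: coeff_map_poly coeff_dual_pderiv coeff_pderiv del: of_nat_Suc)

lemma dre_poly: "dre (poly f x) = poly (map_poly dre f) (dre x)"
  by (induction f) (simp_all add: map_poly_pCons)

text \<open>First-order Taylor expansion; it is exact because \<epsilon>^2 = 0, and for the same
  reason only the real part of the derivative enters.\<close>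

lemma poly_dual_shift:
  "poly f (Dual a c) = poly f (Dual a 0) + Dual 0 (c * poly (pderiv (map_poly dre f)) a)"
proof (induction f)
  case (pCons k f)
  show ?case
    by (simp add: pCons.IH map_poly_pCons pderiv_pCons dual_eq_iff dre_poly algebra_simps)
qed (simp add: dual_eq_iff)

definition coeffs_in :: "'a::zero set \<Rightarrow> 'a poly \<Rightarrow> bool" where
  "coeffs_in A f \<longleftrightarrow> (\<forall>i. coeff f i \<in> A)"

lemma derivation_graph_sum:
  assumes "derivation_graph G" "\<And>i. i \<in> S \<Longrightarrow> f i \<in> G"
  shows "sum f S \<in> G"
  using assms(2)
  by (induction S rule: infinite_finite_induct) (auto intro: derivation_graphD[OF assms(1)])

lemma derivation_graph_of_nat:
  assumes "derivation_graph G" shows "of_nat n \<in> G"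
  by (induction n) (auto intro: derivation_graphD[OF assms])

lemma coeffs_in_graph:
  assumes G: "derivation_graph G"
  shows "coeffs_in G f \<Longrightarrow> coeffs_in G h \<Longrightarrow> coeffs_in G (f + h)"
    and "coeffs_in G f \<Longrightarrow> coeffs_in G h \<Longrightarrow> coeffs_in G (f - h)"
    and "coeffs_in G f \<Longrightarrow> coeffs_in G h \<Longrightarrow> coeffs_in G (f * h)"
    and "coeffs_in G f \<Longrightarrow> coeffs_in G (dual_pderiv f)"
    and "k \<in> G \<Longrightarrow> coeffs_in G f \<Longrightarrow> coeffs_in G (smult k f)"
    and "k \<in> G \<Longrightarrow> coeffs_in G (monom k n)"
  using derivation_graphD[OF G] derivation_graph_of_nat[OF G]
  by (auto simp: coeffs_in_def coeff_mult coeff_dual_pderiv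
      simp del: of_nat_Suc intro!: derivation_graph_sum[OF G])

text \<open>Adjoining \<open>Dual a c\<close>: if \<open>a\<close> is a root of a nonzero polynomial over the domain, then
  \<open>c\<close> is forced by the one of least degree, because its derivative does not vanish at \<open>a\<close>.\<close>
lemma derivation_graph_step:
  assumes G: "derivation_graph G"
  shows "\<exists>c. \<forall>f. coeffs_in G f \<longrightarrow> dre (poly f (Dual a c)) = 0 \<longrightarrow> poly f (Dual a c) = 0"
proof (cases "\<exists>f. coeffs_in G f \<and> f \<noteq> 0 \<and> dre (poly f (Dual a 0)) = 0")
  case False
  \<comment> \<open>Here \<open>a\<close> is transcendental: only the zero polynomial can vanish, so
    \<open>c\<close> is unconstrained and 0 is taken.\<close>
  have "dre (poly f (Dual a 0)) = 0 \<Longrightarrow> coeffs_in G f \<Longrightarrow> poly f (Dual a 0) = 0" for f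
    using False by fastforce
  then show ?thesis by blast
next
  case True
  let ?P = "\<lambda>f. coeffs_in G f \<and> f \<noteq> 0 \<and> dre (poly f (Dual a 0)) = 0"
  obtain m where m: "?P m" and least: "\<And>f. ?P f \<Longrightarrow> degree m \<le> degree f"
    using ex_has_least_nat[of ?P _ degree] True by blast
  \<comment> \<open>In \<open>G\<close> a nonzero element has nonzero real part.\<close>
  have lead: "dre (lead_coeff m) \<noteq> 0"
    using m derivation_graphD(6)[OF G, of "lead_coeff m"] by (auto simp: coeffs_in_def)
  have deg: "degree m > 0"
  proof (rule ccontr)
    assume "\<not> degree m > 0"
    then obtain k where "m = [:k:]" by (metis degree_0_id gr0I)
    then show False using m lead by simp
  qed
  have "dre (coeff (dual_pderiv m) (degree m - 1)) = real (degree m) * dre (lead_coeff m)"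
    using deg by (simp add: coeff_dual_pderiv del: of_nat_Suc)
  then have "dual_pderiv m \<noteq> 0"
    using deg lead by force
  moreover have "degree (dual_pderiv m) \<le> degree m - 1"
    by (intro degree_le) (auto simp: coeff_dual_pderiv coeff_eq_0)
  ultimately have "dre (poly (dual_pderiv m) (Dual a 0)) \<noteq> 0"
    using least[of "dual_pderiv m"] m coeffs_in_graph(4)[OF G] deg by force
  then have d: "poly (pderiv (map_poly dre m)) a \<noteq> 0"
    by (simp add: dre_poly map_poly_dual_pderiv)
  \<comment> \<open>The dual part of \<open>poly m (Dual a c)\<close> is affine in \<open>c\<close>,
    with slope the derivative of \<open>m\<close> at \<open>a\<close>; this is its zero.\<close>
  define c where "c = - dep (poly m (Dual a 0)) / poly (pderiv (map_poly dre m)) a"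
  have re: "dre (poly f (Dual a c)) = dre (poly f (Dual a 0))" for f
    by (simp add: poly_dual_shift[of f a c])
  have root: "poly m (Dual a c) = 0"
    unfolding poly_dual_shift[of m a c] dual_eq_iff using m d by (simp add: c_def)
  have "poly f (Dual a c) = 0" if "coeffs_in G f" "dre (poly f (Dual a c)) = 0" for f
    using that
  proof (induction "degree f" arbitrary: f rule: less_induct)
    case less
    show ?case
    proof (cases "f = 0")
      case False
      then have le: "degree m \<le> degree f"
        using less.prems least re by auto
      \<comment> \<open>One step of pseudo-division by \<open>m\<close>: \<open>G\<close> is only a
        ring, so \<open>f\<close> is multiplied by the leading coefficient instead of dividing by
        it.\<close>
      define h where "h = smult (lead_coeff m) f - monom (lead_coeff f) (degree f - degree m) * m"
      have h: "coeffs_in G h"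
        unfolding h_def using less.prems m
        by (intro coeffs_in_graph[OF G]) (auto simp: coeffs_in_def)
      have h_root: "poly h (Dual a c) = lead_coeff m * poly f (Dual a c)"
        by (simp add: h_def root)
      have "degree (monom (lead_coeff f) (degree f - degree m) * m) \<le> degree f"
        using le degree_mult_le[of "monom (lead_coeff f) (degree f - degree m)" m]
          degree_monom_le[of "lead_coeff f" "degree f - degree m"] by linarith
      moreover have "coeff (monom (lead_coeff f) (degree f - degree m) * m) (degree f)
          = lead_coeff f * lead_coeff m"
        using le by (simp add: coeff_monom_mult)
      ultimately have h0: "degree h \<le> degree f" "coeff h (degree f) = 0"
        unfolding h_def by (auto intro!: degree_diff_le simp: mult.commute degree_smult_le)
      have "poly h (Dual a c) = 0"
      proof (cases "h = 0")
        case False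
        then have "degree h < degree f"
          using h0 by (metis leading_coeff_0_iff le_neq_implies_less)
        then show ?thesis using less.hyps[of h] h h_root less.prems by simp
      qed simp
      then show ?thesis
        using h_root lead less.prems(2) by (simp add: dual_eq_iff)
    qed simp
  qed
  then show ?thesis by blast
qed

text \<open>The extension is the ring generated by \<open>G\<close> and \<open>Dual a c\<close>; the
  \<open>c\<close> of \<open>derivation_graph_step\<close> is what keeps zero its only element with
  vanishing real part.\<close>

lemma derivation_graph_extend:
  assumes G: "derivation_graph G"
  shows "\<exists>H c. derivation_graph H \<and> G \<subseteq> H \<and> Dual a c \<in> H"
proof -
  obtain c where c: "\<And>f. coeffs_in G f \<Longrightarrow> dre (poly f (Dual a c)) = 0 \<Longrightarrow> poly f (Dual a c) = 0"
    using derivation_graph_step[OF G] by blast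
  define H where "H = {poly f (Dual a c) | f. coeffs_in G f}"
  have H: "poly f (Dual a c) \<in> H" if "coeffs_in G f" for f
    using that by (auto simp: H_def)
  have const: "coeffs_in G [:k:]" if "k \<in> G" for k
    using that derivation_graphD(2)[OF G] by (auto simp: coeffs_in_def coeff_pCons split: nat.split)
  have "derivation_graph H"
    unfolding derivation_graph_def
  proof (intro conjI ballI impI)
    show "1 \<in> H" using H[OF const[OF derivation_graphD(1)[OF G]]] by simp
  next
    fix x y assume "x \<in> H" "y \<in> H"
    then obtain f h where fh: "coeffs_in G f" "coeffs_in G h"
      "x = poly f (Dual a c)" "y = poly h (Dual a c)"
      by (auto simp: H_def)
    show "x + y \<in> H" "x - y \<in> H" "x * y \<in> H"
      using H[OF coeffs_in_graph(1)[OF G fh(1,2)]] H[OF coeffs_in_graph(2)[OF G fh(1,2)]]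
        H[OF coeffs_in_graph(3)[OF G fh(1,2)]] fh by simp_all
  qed (use c in \<open>auto simp: H_def\<close>)
  moreover have "G \<subseteq> H"
  proof
    fix k assume "k \<in> G"
    from H[OF const[OF this]] show "k \<in> H" by simp
  qed
  moreover have "Dual a c \<in> H"
    using H[OF coeffs_in_graph(6)[OF G derivation_graphD(1)[OF G], of 1]] by (simp add: poly_monom)
  ultimately show ?thesis by blast
qed

text \<open>By Zorn's lemma there is a maximal graph; as every graph extends to any given real
  number, a maximal one is defined everywhere.\<close>

lemma derivation_graph_total:
  assumes "derivation_graph G0"
  shows "\<exists>D. derivation D \<and> (\<forall>g\<in>G0. D (dre g) = dep g)"
proof -
  let ?A = "{G. derivation_graph G \<and> G0 \<subseteq> G}"
  have "\<exists>M\<in>?A. \<forall>X\<in>?A. M \<subseteq> X \<longrightarrow> X = M"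
  proof (rule subset_Zorn_nonempty)
    show "?A \<noteq> {}" using assms by blast
  next
    fix \<C> assume ne: "\<C> \<noteq> {}" and chain: "subset.chain ?A \<C>"
    have sub: "\<And>C. C \<in> \<C> \<Longrightarrow> derivation_graph C \<and> G0 \<subseteq> C"
      using chain by (auto simp: subset.chain_def)
    have common: "\<exists>C\<in>\<C>. x \<in> C \<and> y \<in> C" if xy: "x \<in> \<Union>\<C>" "y \<in> \<Union>\<C>" for x y
    proof -
      obtain C C' where "C \<in> \<C>" "C' \<in> \<C>" "x \<in> C" "y \<in> C'"
        using xy by blast
      moreover have "C \<subseteq> C' \<or> C' \<subseteq> C"
        using chain calculation(1,2) by (auto simp: subset_chain_def)
      ultimately show ?thesis by blast
    qed
    have "derivation_graph (\<Union>\<C>)"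
      unfolding derivation_graph_def
    proof (intro conjI ballI impI)
      show "1 \<in> \<Union>\<C>" using ne sub derivation_graphD(1) by fast
    next
      fix x y assume "x \<in> \<Union>\<C>" "y \<in> \<Union>\<C>"
      then obtain C where "C \<in> \<C>" "x \<in> C" "y \<in> C" using common by blast
      then show "x + y \<in> \<Union>\<C>" "x - y \<in> \<Union>\<C>" "x * y \<in> \<Union>\<C>"
        using derivation_graphD(3-5)[of C x y] sub by auto
    next
      fix x :: dual assume "x \<in> \<Union>\<C>" "dre x = 0"
      then show "x = 0" using sub derivation_graphD(6)[of _ x] by auto
    qed
    then show "\<Union>\<C> \<in> ?A" using ne sub by blast
  qed
  then obtain M where "M \<in> ?A" and maximal: "\<forall>X\<in>?A. M \<subseteq> X \<longrightarrow> X = M" ..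
  then have M: "derivation_graph M" "G0 \<subseteq> M" by simp_all
  have max: "X = M" if "derivation_graph X" "M \<subseteq> X" for X
    using that M(2) maximal by auto
  have total: "\<exists>c. Dual a c \<in> M" for a
  proof -
    obtain H c where "derivation_graph H" "M \<subseteq> H" "Dual a c \<in> H"
      using derivation_graph_extend[OF M(1), of a] by blast
    then show ?thesis using max[of H] by auto
  qed
  have unique: "x = y" if "x \<in> M" "y \<in> M" "dre x = dre y" for x y
    using derivation_graphD(6)[OF M(1) derivation_graphD(4)[OF M(1) that(1,2)]] that(3) by simp
  define D where "D a = (SOME c. Dual a c \<in> M)" for a
  have D: "Dual a (D a) \<in> M" for a
    unfolding D_def using someI_ex[OF total] .
  have D_eq: "D (dre x) = dep x" if "x \<in> M" for x
    using arg_cong[OF unique[OF D[of "dre x"] that], of dep] by simp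
  have "derivation D"
    unfolding derivation_def
  proof (intro conjI allI)
    fix x y
    show "D (x + y) = D x + D y"
      using D_eq[OF derivation_graphD(3)[OF M(1) D[of x] D[of y]]] by simp
    show "D (x * y) = D x * y + x * D y"
      using D_eq[OF derivation_graphD(5)[OF M(1) D[of x] D[of y]]] by simp
  qed
  then show ?thesis using D_eq M(2) by blast
qed

section \<open>Rational polynomials evaluated at dual numbers\<close>

definition monomial_at :: "('a \<Rightarrow> 'b) \<Rightarrow> ('a \<Rightarrow>\<^sub>0 nat) \<Rightarrow> 'b::comm_ring_1" where
  "monomial_at g m = (\<Prod>a\<in>Poly_Mapping.keys m. g a ^ Poly_Mapping.lookup m a)"

definition mpoly_at :: "('c \<Rightarrow> 'b) \<Rightarrow> ('a \<Rightarrow> 'b) \<Rightarrow> (('a \<Rightarrow>\<^sub>0 nat) \<Rightarrow>\<^sub>0 'c::zero) \<Rightarrow> 'b::comm_ring_1" where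
  "mpoly_at h g P =
     (\<Sum>m\<in>Poly_Mapping.keys P. h (Poly_Mapping.lookup P m) * monomial_at g m)"

lemma poly_mapping_additive_induct [case_names zero single add]:
  assumes zero: "P 0" and single: "\<And>m c. P (Poly_Mapping.single m c)"
    and add: "\<And>f g. P f \<Longrightarrow> P g \<Longrightarrow> P (f + g)"
  shows "P (f :: 'a \<Rightarrow>\<^sub>0 'b::monoid_add)"
proof (induction f rule: update_induct)
  case (update f a b)
  have "Poly_Mapping.update a b f = Poly_Mapping.single a b + f"
    using update(1)
    by (intro poly_mapping_eqI) (auto simp: lookup_update lookup_add lookup_single in_keys_iff when_def)
  then show ?case using single add update by simp
qed (rule zero)

lemma monomial_at_superset:
  assumes "finite S" "Poly_Mapping.keys m \<subseteq> S"
  shows "monomial_at g m = (\<Prod>a\<in>S. g a ^ Poly_Mapping.lookup m a)"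
  unfolding monomial_at_def
  using assms by (intro prod.mono_neutral_left) (auto simp: in_keys_iff)

lemma monomial_at_0: "monomial_at g 0 = 1"
  by (simp add: monomial_at_def)

lemma monomial_at_add: "monomial_at g (m + m') = monomial_at g m * monomial_at g m'"
proof -
  let ?S = "Poly_Mapping.keys m \<union> Poly_Mapping.keys m'"
  have "monomial_at g (m + m') = (\<Prod>a\<in>?S. g a ^ Poly_Mapping.lookup (m + m') a)"
    by (intro monomial_at_superset) (use Poly_Mapping.keys_add[of m m'] in auto)
  also have "\<dots> = (\<Prod>a\<in>?S. g a ^ Poly_Mapping.lookup m a) * (\<Prod>a\<in>?S. g a ^ Poly_Mapping.lookup m' a)"
    by (simp add: lookup_add power_add prod.distrib)
  also have "\<dots> = monomial_at g m * monomial_at g m'"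
    using monomial_at_superset[of ?S m g] monomial_at_superset[of ?S m' g] by simp
  finally show ?thesis .
qed

lemma mpoly_at_superset:
  assumes "finite S" "Poly_Mapping.keys P \<subseteq> S" "h 0 = 0"
  shows "mpoly_at h g P = (\<Sum>m\<in>S. h (Poly_Mapping.lookup P m) * monomial_at g m)"
  unfolding mpoly_at_def
  using assms by (intro sum.mono_neutral_left) (auto simp: in_keys_iff)

lemma mpoly_at_single: "h 0 = 0 \<Longrightarrow> mpoly_at h g (Poly_Mapping.single m c) = h c * monomial_at g m"
  by (simp add: mpoly_at_def)

context
  fixes h :: "'c::comm_ring_1 \<Rightarrow> 'b::comm_ring_1"
  assumes h_0: "h 0 = 0" and h_add: "\<And>x y. h (x + y) = h x + h y"
    and h_mult: "\<And>x y. h (x * y) = h x * h y"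
begin

lemma mpoly_at_add: "mpoly_at h g (P + Q) = mpoly_at h g P + mpoly_at h g Q"
proof -
  let ?S = "Poly_Mapping.keys P \<union> Poly_Mapping.keys Q"
  have "mpoly_at h g (P + Q) = (\<Sum>m\<in>?S. h (Poly_Mapping.lookup (P + Q) m) * monomial_at g m)"
    by (intro mpoly_at_superset h_0) (use Poly_Mapping.keys_add[of P Q] in auto)
  also have "\<dots> = mpoly_at h g P + mpoly_at h g Q"
    using mpoly_at_superset[of ?S P h g] mpoly_at_superset[of ?S Q h g]
    by (simp add: lookup_add h_add h_0 algebra_simps sum.distrib)
  finally show ?thesis .
qed

text \<open>Both sides are biadditive, so products of single terms suffice.\<close>

lemma mpoly_at_mult: "mpoly_at h g (P * Q) = mpoly_at h g P * mpoly_at h g Q"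
proof (induction P rule: poly_mapping_additive_induct)
  case (single m c)
  show ?case
  proof (induction Q rule: poly_mapping_additive_induct)
    case (single m' c')
    show ?case
      by (simp add: mult_single mpoly_at_single h_0 h_mult monomial_at_add mult_ac)
  next
    case (add Q1 Q2)
    then show ?case by (simp add: mpoly_at_add distrib_left)
  qed (simp add: mpoly_at_def)
next
  case (add P1 P2)
  then show ?case by (simp add: mpoly_at_add distrib_right)
qed (simp add: mpoly_at_def)

end

text \<open>Substitute b + \<epsilon> u(b) for each label b. By independence only the zero
  polynomial has value with real part 0, so the values form a derivation graph, which is then
  extended to all reals.\<close>

lemma exists_derivation_on_independent:
  assumes B: "algebraically_independent B"
  shows "\<exists>D. derivation D \<and> (\<forall>b\<in>B. D b = u b)"
proof -
  let ?h = "\<lambda>r::rat. Dual (of_rat r) 0"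
  let ?g = "\<lambda>b. Dual b (u b)"
  let ?B = "\<lambda>P. \<forall>m\<in>Poly_Mapping.keys P. Poly_Mapping.keys m \<subseteq> B"
  define ev where "ev = mpoly_at ?h ?g"
  define G0 where "G0 = {ev P | P. ?B P}"
  have G0I: "ev P \<in> G0" if "?B P" for P using that by (auto simp: G0_def)
  have h: "?h 0 = 0" "?h (x + y) = ?h x + ?h y" "?h (x * y) = ?h x * ?h y" "?h 1 = 1" for x y
    by (simp_all add: dual_eq_iff of_rat_add of_rat_mult)
  have add: "ev (P + Q) = ev P + ev Q" and mult: "ev (P * Q) = ev P * ev Q" for P Q
    unfolding ev_def using h mpoly_at_add[of ?h] mpoly_at_mult[of ?h] by blast+
  have diff: "ev (P - Q) = ev P - ev Q" for P Q
    using add[of "P - Q" Q] by (simp add: algebra_simps)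
  have re: "dre (ev P) = eval_at_labels P" for P
    by (simp add: ev_def mpoly_at_def monomial_at_def eval_at_labels_def dre_sum dre_prod)
  have "derivation_graph G0"
    unfolding derivation_graph_def
  proof (intro conjI ballI impI)
    have "ev 1 = 1"
      using mpoly_at_single[of ?h ?g 0 1] h by (simp add: ev_def monomial_at_0 single_one)
    then show "1 \<in> G0" using G0I[of 1] by simp
  next
    fix x y assume "x \<in> G0" "y \<in> G0"
    then obtain P Q where PQ: "?B P" "?B Q" "x = ev P" "y = ev Q" by (auto simp: G0_def)
    have "?B (P + Q)" using PQ Poly_Mapping.keys_add[of P Q] by blast
    then show "x + y \<in> G0" using G0I[of "P + Q"] PQ add by simp
    have "?B (P - Q)" using PQ keys_diff[of P Q] by blast
    then show "x - y \<in> G0" using G0I[of "P - Q"] PQ diff by simp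
    have "?B (P * Q)"
    proof
      fix m assume "m \<in> Poly_Mapping.keys (P * Q)"
      then obtain m1 m2 where "m1 \<in> Poly_Mapping.keys P" "m2 \<in> Poly_Mapping.keys Q" "m = m1 + m2"
        using keys_mult[of P Q] by blast
      then show "Poly_Mapping.keys m \<subseteq> B"
        using PQ Poly_Mapping.keys_add[of m1 m2] by blast
    qed
    then show "x * y \<in> G0" using G0I[of "P * Q"] PQ mult by simp
  next
    fix x assume "x \<in> G0" and x: "dre x = 0"
    then obtain P where P: "?B P" "x = ev P" by (auto simp: G0_def)
    then have "P = 0" using B x re unfolding algebraically_independent_def by metis
    then show "x = 0" using P by (simp add: ev_def mpoly_at_def)
  qed
  then obtain D where D: "derivation D" "\<And>g. g \<in> G0 \<Longrightarrow> D (dre g) = dep g"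
    using derivation_graph_total by blast
  have "D b = u b" if "b \<in> B" for b
  proof -
    let ?P = "Poly_Mapping.single (Poly_Mapping.single b 1) (1::rat)"
    have "ev ?P = Dual b (u b)"
      using mpoly_at_single[of ?h ?g] h by (simp add: ev_def monomial_at_def dual_eq_iff)
    moreover have "ev ?P \<in> G0" using that by (intro G0I) auto
    ultimately show ?thesis using D(2)[of "ev ?P"] by simp
  qed
  then show ?thesis using D(1) by blast
qed

section \<open>Motions of generic frameworks\<close>

text \<open>\<open>\<alpha> v\<close> is the angular and \<open>\<zeta> v\<close> the vertical
  velocity of \<open>v\<close>: together they are the tangent vector D(c).\<close>

definition moves :: "(real \<Rightarrow> real) \<Rightarrow> ('v \<Rightarrow> real^3) \<Rightarrow> ('v \<Rightarrow> real) \<Rightarrow> ('v \<Rightarrow> real) \<Rightarrow> bool" where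
  "moves D c \<alpha> \<zeta> \<longleftrightarrow> derivation D \<and>
     (\<forall>v. D (c v $ 1) = - (\<alpha> v * c v $ 2) \<and> D (c v $ 2) = \<alpha> v * c v $ 1 \<and> D (c v $ 3) = \<zeta> v)"

lemma on_cylinderD: "on_cylinder c \<Longrightarrow> (c v $ 1)\<^sup>2 + (c v $ 2)\<^sup>2 = 1"
  by (simp add: on_cylinder_def unit_cylinder_def)

text \<open>Differentiating x^2 + y^2 = 1 shows that (D x, D y) is a multiple of (-y, x).\<close>

lemma moves_of_derivation:
  assumes D: "derivation D" and c: "on_cylinder c"
  shows "moves D c (\<lambda>v. c v $ 1 * D (c v $ 2) - c v $ 2 * D (c v $ 1)) (\<lambda>v. D (c v $ 3))"
proof -
  have tangent: "c v $ 1 * D (c v $ 1) + c v $ 2 * D (c v $ 2) = 0" for v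
    using arg_cong[OF on_cylinderD[OF c, of v], of D]
    by (simp add: derivation_simps[OF D])
  show ?thesis
    unfolding moves_def
  proof (intro conjI allI D refl)
    fix v
    let ?x = "c v $ 1" and ?y = "c v $ 2"
    have n: "?x * ?x + ?y * ?y = 1"
      using on_cylinderD[OF c, of v] by (simp add: power2_eq_square)
    show "D ?x = - ((?x * D ?y - ?y * D ?x) * ?y)"
      using n tangent[of v] by algebra
    show "D ?y = (?x * D ?y - ?y * D ?x) * ?x"
      using n tangent[of v] by algebra
  qed
qed

text \<open>The form in which genericity enters all geometric arguments below.\<close>

definition free_motion :: "('v \<Rightarrow> real^3) \<Rightarrow> bool" where
  "free_motion p \<longleftrightarrow> on_cylinder p \<and> (\<forall>\<alpha> \<zeta>. \<exists>D. moves D p \<alpha> \<zeta>)"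

text \<open>The derivations dual to a transcendence basis of the field of coordinates give as many
  independent tangent vectors as the dimension of the configuration space.\<close>
lemma generic_imp_free_motion:
  fixes p :: "'v::finite \<Rightarrow> real^3"
  assumes "generic_on_cylinder p"
  shows "free_motion p"
proof -
  let ?F = "generated_field {p v $ k | v k. True}"
  have p: "on_cylinder p" using assms by (simp add: generic_on_cylinder_def)
  obtain B where B: "B \<subseteq> ?F" "algebraically_independent B" "finite B" "card B = 2 * CARD('v)"
    using assms by (auto simp: generic_on_cylinder_def has_transcendence_degree_def transcendence_basis_def)
  have "card B = CARD('v + 'v)" using B by simp
  then obtain e :: "'v + 'v \<Rightarrow> real" where e: "bij_betw e UNIV B"
    using B(3) by (metis finite_class.finite_UNIV finite_same_card_bij)
  have "\<exists>D. derivation D \<and> (\<forall>b\<in>B. D b = (if b = e s then 1 else 0))" for s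
    by (rule exists_derivation_on_independent[OF B(2)])
  then obtain \<Delta> where \<Delta>: "\<And>s. derivation (\<Delta> s)"
    and \<Delta>_B: "\<And>s b. b \<in> B \<Longrightarrow> \<Delta> s b = (if b = e s then 1 else 0)"
    by metis
  define rate :: "(real \<Rightarrow> real) \<Rightarrow> real^('v + 'v)" where
    "rate D = (\<chi> s. case s of Inl v \<Rightarrow> p v $ 1 * D (p v $ 2) - p v $ 2 * D (p v $ 1)
                      | Inr v \<Rightarrow> D (p v $ 3))" for D
  define comb :: "real^('v + 'v) \<Rightarrow> real \<Rightarrow> real" where
    "comb r x = (\<Sum>s\<in>UNIV. r $ s * \<Delta> s x)" for r x
  have comb: "derivation (comb r)" for r
    unfolding comb_def by (intro derivation_linear_combination \<Delta>)
  have rate: "moves D p (\<lambda>v. rate D $ Inl v) (\<lambda>v. rate D $ Inr v)" if "derivation D" for D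
    using moves_of_derivation[OF that p] by (simp add: rate_def)
  have lin: "linear (\<lambda>r. rate (comb r))"
    by (intro linearI)
      (simp_all add: vec_eq_iff rate_def comb_def algebra_simps sum.distrib sum_distrib_left
        split: sum.split)
  \<comment> \<open>If \<open>comb r\<close> fixes all coordinates, it kills the field they generate
    and hence \<open>B\<close>, on which its values are the entries of \<open>r\<close>. Domain and
    target both have dimension 2n, so injectivity gives surjectivity.\<close>
  have "r = 0" if "rate (comb r) = 0" for r
  proof -
    have "comb r x = 0" if x_coord: "x \<in> {p v $ k | v k. True}" for x
    proof -
      obtain v k where x: "x = p v $ k" using x_coord by blast
      show ?thesis
        using rate[OF comb[of r]] \<open>rate (comb r) = 0\<close> exhaust_3[of k] by (auto simp: moves_def x)
    qed
    then have zero: "comb r b = 0" if "b \<in> B" for b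
      using derivation_zero_on_generated_field[OF comb, of "{p v $ k | v k. True}"] B(1) that by blast
    have "r $ s = 0" for s
    proof -
      have "e s \<in> B" using e by (auto simp: bij_betw_def)
      moreover have "comb r (e s) = (\<Sum>t\<in>UNIV. if t = s then r $ t else 0)"
        unfolding comb_def
      proof (intro sum.cong refl)
        fix t
        have "e s = e t \<longleftrightarrow> t = s" using e by (auto simp: bij_betw_def inj_def)
        then show "r $ t * \<Delta> t (e s) = (if t = s then r $ t else 0)"
          using \<Delta>_B[OF \<open>e s \<in> B\<close>, of t] by simp
      qed
      ultimately show ?thesis using zero[of "e s"] by simp
    qed
    then show ?thesis by (simp add: vec_eq_iff)
  qed
  then have "inj (\<lambda>r. rate (comb r))"
    using linear_injective_0[OF lin] by blast
  then have surj: "surj (\<lambda>r. rate (comb r))"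
    using linear_injective_imp_surjective[OF lin] by blast
  have "\<exists>D. moves D p \<alpha> \<zeta>" for \<alpha> \<zeta>
  proof -
    obtain r where r: "rate (comb r) = (\<chi> s. case s of Inl v \<Rightarrow> \<alpha> v | Inr v \<Rightarrow> \<zeta> v)"
      using surj by (metis surjD)
    then show ?thesis using rate[OF comb[of r]] by auto
  qed
  then show ?thesis using p by (simp add: free_motion_def)
qed

section \<open>Integer polynomials in the coordinates and their vanishing at free
  configurations\<close>

datatype 'v cpoly = Coeff int | XVar 'v | YVar 'v | ZVar 'v
  | Add "'v cpoly" "'v cpoly" | Mul "'v cpoly" "'v cpoly"

text \<open>The polynomials are syntactic so that one expression can be evaluated both at real
  points and along a path of power series.\<close>

primrec cpoly_at ::
    "('v \<Rightarrow> 'a) \<Rightarrow> ('v \<Rightarrow> 'a) \<Rightarrow> ('v \<Rightarrow> 'a) \<Rightarrow> 'v cpoly \<Rightarrow> 'a::comm_ring_1" where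
  "cpoly_at x y z (Coeff k) = of_int k"
| "cpoly_at x y z (XVar v) = x v"
| "cpoly_at x y z (YVar v) = y v"
| "cpoly_at x y z (ZVar v) = z v"
| "cpoly_at x y z (Add f g) = cpoly_at x y z f + cpoly_at x y z g"
| "cpoly_at x y z (Mul f g) = cpoly_at x y z f * cpoly_at x y z g"

text \<open>The derivative along the rotation of vertex \<open>w\<close> about the axis of the cylinder.\<close>
primrec rotation_deriv :: "'v \<Rightarrow> 'v cpoly \<Rightarrow> 'v cpoly" where
  "rotation_deriv w (Coeff k) = Coeff 0"
| "rotation_deriv w (XVar v) = (if v = w then Mul (Coeff (- 1)) (YVar v) else Coeff 0)"
| "rotation_deriv w (YVar v) = (if v = w then XVar v else Coeff 0)"
| "rotation_deriv w (ZVar v) = Coeff 0"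
| "rotation_deriv w (Add f g) = Add (rotation_deriv w f) (rotation_deriv w g)"
| "rotation_deriv w (Mul f g) = Add (Mul (rotation_deriv w f) g) (Mul f (rotation_deriv w g))"

primrec vertical_deriv :: "'v \<Rightarrow> 'v cpoly \<Rightarrow> 'v cpoly" where
  "vertical_deriv w (Coeff k) = Coeff 0"
| "vertical_deriv w (XVar v) = Coeff 0"
| "vertical_deriv w (YVar v) = Coeff 0"
| "vertical_deriv w (ZVar v) = Coeff (if v = w then 1 else 0)"
| "vertical_deriv w (Add f g) = Add (vertical_deriv w f) (vertical_deriv w g)"
| "vertical_deriv w (Mul f g) = Add (Mul (vertical_deriv w f) g) (Mul f (vertical_deriv w g))"

text \<open>The chain rule, used for derivations of the reals at \<open>p\<close> and for
  \<open>fps_deriv\<close> along a path.\<close>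

lemma derivation_cpoly_at:
  fixes x y z :: "'v::finite \<Rightarrow> 'a::comm_ring_1"
  assumes D: "derivation D" and x: "\<And>v. D (x v) = - (\<alpha> v * y v)" and y: "\<And>v. D (y v) = \<alpha> v * x v"
    and z: "\<And>v. D (z v) = \<zeta> v"
  shows "D (cpoly_at x y z f) =
    (\<Sum>w\<in>UNIV. \<alpha> w * cpoly_at x y z (rotation_deriv w f) + \<zeta> w * cpoly_at x y z (vertical_deriv w f))"
proof (induction f)
  case (XVar v)
  have "(\<Sum>w\<in>UNIV. \<alpha> w * cpoly_at x y z (rotation_deriv w (XVar v))
        + \<zeta> w * cpoly_at x y z (vertical_deriv w (XVar v)))
      = (\<Sum>w\<in>UNIV. if w = v then - (\<alpha> v * y v) else 0)"
    by (intro sum.cong) auto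
  then show ?case by (simp add: x)
next
  case (YVar v)
  have "(\<Sum>w\<in>UNIV. \<alpha> w * cpoly_at x y z (rotation_deriv w (YVar v))
        + \<zeta> w * cpoly_at x y z (vertical_deriv w (YVar v)))
      = (\<Sum>w\<in>UNIV. if w = v then \<alpha> v * x v else 0)"
    by (intro sum.cong) auto
  then show ?case by (simp add: y)
next
  case (ZVar v)
  have "(\<Sum>w\<in>UNIV. \<alpha> w * cpoly_at x y z (rotation_deriv w (ZVar v))
        + \<zeta> w * cpoly_at x y z (vertical_deriv w (ZVar v)))
      = (\<Sum>w\<in>UNIV. if w = v then \<zeta> v else 0)"
    by (intro sum.cong) auto
  then show ?case by (simp add: z)
next
  case (Add f g)
  then show ?case by (simp add: derivation_simps[OF D] sum.distrib algebra_simps)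
next
  case (Mul f g)
  then show ?case
    by (simp add: derivation_simps[OF D] sum.distrib sum_distrib_left sum_distrib_right algebra_simps)
qed (simp add: derivation_simps[OF D])

lemma derivation_fps_deriv: "derivation (fps_deriv :: 'a::comm_ring_1 fps \<Rightarrow> 'a fps)"
  by (simp add: derivation_def add.commute)

abbreviation cpoly_at_conf :: "('v \<Rightarrow> real^3) \<Rightarrow> 'v cpoly \<Rightarrow> real" where
  "cpoly_at_conf c \<equiv> cpoly_at (\<lambda>v. c v $ 1) (\<lambda>v. c v $ 2) (\<lambda>v. c v $ 3)"

lemma fps_conv_radius_top_add:
  fixes f g :: "real fps"
  assumes "fps_conv_radius f = \<infinity>" "fps_conv_radius g = \<infinity>"
  shows "fps_conv_radius (f + g) = \<infinity>" "fps_conv_radius (f - g) = \<infinity>" "fps_conv_radius (f * g) = \<infinity>"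
  using fps_conv_radius_add[of f g] fps_conv_radius_diff[of f g] fps_conv_radius_mult[of f g] assms
  by auto

lemma eval_fps_cpoly_at:
  fixes x y z :: "'v \<Rightarrow> real fps"
  assumes "\<And>v. fps_conv_radius (x v) = \<infinity>" "\<And>v. fps_conv_radius (y v) = \<infinity>"
    "\<And>v. fps_conv_radius (z v) = \<infinity>"
  shows "fps_conv_radius (cpoly_at x y z f) = \<infinity> \<and>
    eval_fps (cpoly_at x y z f) t =
      cpoly_at (\<lambda>v. eval_fps (x v) t) (\<lambda>v. eval_fps (y v) t) (\<lambda>v. eval_fps (z v) t) f"
proof (induction f)
  case (Coeff k)
  show ?case by (simp flip: fps_of_int)
qed (use assms in \<open>simp_all add: fps_conv_radius_top_add eval_fps_add eval_fps_mult\<close>)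

text \<open>By free motion, all iterated derivatives of \<open>f\<close> along the cylinder vanish at \<open>p\<close>; hence so does
  the Taylor series of \<open>f\<close> along a helical path from \<open>p\<close> to \<open>q\<close>.\<close>
lemma cpoly_vanishes_everywhere:
  fixes p q :: "'v::finite \<Rightarrow> real^3"
  assumes p: "free_motion p" and f: "cpoly_at_conf p f = 0" and q: "on_cylinder q"
  shows "cpoly_at_conf q f = 0"
proof -
  have cyl_p: "on_cylinder p" using p by (simp add: free_motion_def)
  \<comment> \<open>A derivation with prescribed velocities kills the value 0; indicator velocities
    then isolate each partial derivative.\<close>
  have deriv_p: "cpoly_at_conf p (rotation_deriv w g) = 0 \<and> cpoly_at_conf p (vertical_deriv w g) = 0"
    if g: "cpoly_at_conf p g = 0" for g w
  proof -
    have sum0: "(\<Sum>w\<in>UNIV. \<alpha> w * cpoly_at_conf p (rotation_deriv w g)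
        + \<zeta> w * cpoly_at_conf p (vertical_deriv w g)) = 0" for \<alpha> \<zeta>
    proof -
      obtain D where D: "moves D p \<alpha> \<zeta>" using p by (auto simp: free_motion_def)
      have "D (cpoly_at_conf p g) = 0" using D g by (simp add: moves_def derivation_0)
      then show ?thesis
        using D by (subst (asm) derivation_cpoly_at[where \<alpha>=\<alpha> and \<zeta>=\<zeta>]) (auto simp: moves_def)
    qed
    have "(\<Sum>v\<in>UNIV. if v = w then h v else 0) = h w" for h :: "'v \<Rightarrow> real" by simp
    moreover have "(\<Sum>v\<in>UNIV. if v = w then cpoly_at_conf p (rotation_deriv v g) else 0) = 0"
      using sum0[of "\<lambda>v. if v = w then 1 else 0" "\<lambda>v. 0"] by (simp add: if_distrib[of "\<lambda>r. r * _"] cong: if_cong)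
    moreover have "(\<Sum>v\<in>UNIV. if v = w then cpoly_at_conf p (vertical_deriv v g) else 0) = 0"
      using sum0[of "\<lambda>v. 0" "\<lambda>v. if v = w then 1 else 0"] by (simp add: if_distrib[of "\<lambda>r. r * _"] cong: if_cong)
    ultimately show ?thesis by simp
  qed
  \<comment> \<open>The angle from \<open>p v\<close> to \<open>q v\<close>.\<close>
  have "\<exists>\<alpha>. cos \<alpha> = p v $ 1 * q v $ 1 + p v $ 2 * q v $ 2 \<and> sin \<alpha> = p v $ 1 * q v $ 2 - p v $ 2 * q v $ 1" for v
  proof -
    have "(p v $ 1 * q v $ 1 + p v $ 2 * q v $ 2)\<^sup>2 + (p v $ 1 * q v $ 2 - p v $ 2 * q v $ 1)\<^sup>2
        = ((p v $ 1)\<^sup>2 + (p v $ 2)\<^sup>2) * ((q v $ 1)\<^sup>2 + (q v $ 2)\<^sup>2)"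
      by algebra
    also have "\<dots> = 1" using on_cylinderD[OF cyl_p, of v] on_cylinderD[OF q, of v] by simp
    finally show ?thesis using sincos_total_2pi_le by metis
  qed
  then obtain \<alpha> where \<alpha>: "\<And>v. cos (\<alpha> v) = p v $ 1 * q v $ 1 + p v $ 2 * q v $ 2"
    "\<And>v. sin (\<alpha> v) = p v $ 1 * q v $ 2 - p v $ 2 * q v $ 1"
    by metis
  \<comment> \<open>The path turns \<open>v\<close> by \<open>\<alpha> v\<close> times t and raises
    it linearly; it is at \<open>p\<close> for t = 0 and at \<open>q\<close> for t = 1.\<close>
  define x where "x v = fps_const (p v $ 1) * fps_cos (\<alpha> v) - fps_const (p v $ 2) * fps_sin (\<alpha> v)" for v
  define y where "y v = fps_const (p v $ 2) * fps_cos (\<alpha> v) + fps_const (p v $ 1) * fps_sin (\<alpha> v)" for v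
  define z where "z v = fps_const (p v $ 3) + fps_const (q v $ 3 - p v $ 3) * fps_X" for v
  have radius: "fps_conv_radius (x v) = \<infinity>" "fps_conv_radius (y v) = \<infinity>" "fps_conv_radius (z v) = \<infinity>" for v
    unfolding x_def y_def z_def by (intro fps_conv_radius_top_add; simp)+
  have path_deriv: "fps_deriv (x v) = - (fps_const (\<alpha> v) * y v)" "fps_deriv (y v) = fps_const (\<alpha> v) * x v"
    "fps_deriv (z v) = fps_const (q v $ 3 - p v $ 3)" for v
    by (simp_all add: x_def y_def z_def fps_sin_deriv fps_cos_deriv algebra_simps
        fps_const_neg[symmetric] del: fps_const_neg)
  have start: "fps_nth (cpoly_at x y z g) 0 = cpoly_at_conf p g" for g
    by (induction g) (simp_all add: x_def y_def z_def fps_of_int[symmetric])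
  \<comment> \<open>Generalised over \<open>g\<close>: coefficient n + 1 comes from coefficient n of
    the derivative, a combination of the derived polynomials, which vanish at \<open>p\<close>
    too.\<close>
  have "fps_nth (cpoly_at x y z g) n = 0" if "cpoly_at_conf p g = 0" for g n
    using that
  proof (induction n arbitrary: g)
    case (Suc n)
    have "of_nat (Suc n) * fps_nth (cpoly_at x y z g) (Suc n) = fps_nth (fps_deriv (cpoly_at x y z g)) n"
      by simp
    also have "\<dots> = 0"
      using Suc deriv_p[OF Suc.prems]
      by (subst derivation_cpoly_at[OF derivation_fps_deriv path_deriv]) (simp add: fps_sum_nth)
    finally show ?case by simp
  qed (simp add: start)
  then have "cpoly_at x y z f = 0" using f by (simp add: fps_eq_iff)
  then have "cpoly_at (\<lambda>v. eval_fps (x v) 1) (\<lambda>v. eval_fps (y v) 1) (\<lambda>v. eval_fps (z v) 1) f = 0"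
    using eval_fps_cpoly_at[of x y z f 1] radius by simp
  moreover have "eval_fps (x v) 1 = q v $ 1" "eval_fps (y v) 1 = q v $ 2" "eval_fps (z v) 1 = q v $ 3" for v
  proof -
    let ?a = "p v $ 1" and ?b = "p v $ 2"
    have n: "?a * ?a + ?b * ?b = 1"
      using on_cylinderD[OF cyl_p, of v] by (simp add: power2_eq_square)
    have "eval_fps (x v) 1 = ?a * cos (\<alpha> v) - ?b * sin (\<alpha> v)"
      by (simp add: x_def eval_fps_diff eval_fps_mult fps_conv_radius_top_add)
    also have "\<dots> = q v $ 1" unfolding \<alpha> using n by algebra
    finally show "eval_fps (x v) 1 = q v $ 1" .
    have "eval_fps (y v) 1 = ?b * cos (\<alpha> v) + ?a * sin (\<alpha> v)"
      by (simp add: y_def eval_fps_add eval_fps_mult fps_conv_radius_top_add)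
    also have "\<dots> = q v $ 2" unfolding \<alpha> using n by algebra
    finally show "eval_fps (y v) 1 = q v $ 2" .
    show "eval_fps (z v) 1 = q v $ 3"
      by (simp add: z_def eval_fps_add eval_fps_mult fps_conv_radius_top_add)
  qed
  ultimately show ?thesis by simp
qed

section \<open>Polynomial functions and semicontinuity of rank\<close>

definition polynomial_fun :: "(('v \<Rightarrow> real^3) \<Rightarrow> real) \<Rightarrow> bool" where
  "polynomial_fun F \<longleftrightarrow> (\<exists>f. \<forall>c. F c = cpoly_at_conf c f)"

lemma polynomial_fun_of_int: "polynomial_fun (\<lambda>c. of_int k)"
  unfolding polynomial_fun_def by (rule exI[of _ "Coeff k"]) simp

lemma polynomial_fun_coordinate: "polynomial_fun (\<lambda>c. c v $ k)"
proof -
  consider "k = 1" | "k = 2" | "k = 3" using exhaust_3[of k] by blast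
  then show ?thesis
    unfolding polynomial_fun_def
    by cases (rule exI[of _ "XVar v"] exI[of _ "YVar v"] exI[of _ "ZVar v"], simp)+
qed

lemma polynomial_fun_add:
  assumes "polynomial_fun F" "polynomial_fun G" shows "polynomial_fun (\<lambda>c. F c + G c)"
proof -
  obtain f g where "\<forall>c. F c = cpoly_at_conf c f" "\<forall>c. G c = cpoly_at_conf c g"
    using assms unfolding polynomial_fun_def by auto
  then show ?thesis unfolding polynomial_fun_def by (intro exI[of _ "Add f g"]) simp
qed

lemma polynomial_fun_mult:
  assumes "polynomial_fun F" "polynomial_fun G" shows "polynomial_fun (\<lambda>c. F c * G c)"
proof -
  obtain f g where "\<forall>c. F c = cpoly_at_conf c f" "\<forall>c. G c = cpoly_at_conf c g"
    using assms unfolding polynomial_fun_def by auto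
  then show ?thesis unfolding polynomial_fun_def by (intro exI[of _ "Mul f g"]) simp
qed

lemma polynomial_fun_diff: "polynomial_fun F \<Longrightarrow> polynomial_fun G \<Longrightarrow> polynomial_fun (\<lambda>c. F c - G c)"
  using polynomial_fun_add[OF _ polynomial_fun_mult[OF polynomial_fun_of_int[of "-1"]], of F G] by simp

lemma polynomial_fun_sum:
  "(\<And>i. i \<in> S \<Longrightarrow> polynomial_fun (F i)) \<Longrightarrow> polynomial_fun (\<lambda>c. \<Sum>i\<in>S. F i c)"
  using polynomial_fun_of_int[of 0]
  by (induction S rule: infinite_finite_induct) (auto intro: polynomial_fun_add)

lemma polynomial_fun_prod:
  "(\<And>i. i \<in> S \<Longrightarrow> polynomial_fun (F i)) \<Longrightarrow> polynomial_fun (\<lambda>c. \<Prod>i\<in>S. F i c)"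
  using polynomial_fun_of_int[of 1]
  by (induction S rule: infinite_finite_induct) (auto intro: polynomial_fun_mult)

lemma polynomial_fun_det:
  assumes "\<And>i j. polynomial_fun (\<lambda>c. A c $ i $ j)"
  shows "polynomial_fun (\<lambda>c. det (A c :: real^'n^'n))"
  unfolding det_def
  by (intro polynomial_fun_sum polynomial_fun_mult polynomial_fun_of_int polynomial_fun_prod assms)

text \<open>The identity block outside \<open>S\<close> keeps the size fixed, so that independence of the columns of \<open>A\<close>
  in \<open>S\<close> is the nonvanishing of a single determinant.\<close>
definition column_gram :: "real^'n^'m \<Rightarrow> 'n set \<Rightarrow> real^'n^'n" where
  "column_gram A S = (\<chi> a b. if a \<in> S \<and> b \<in> S then \<Sum>m\<in>UNIV. A $ m $ a * A $ m $ b
     else if a = b then 1 else 0)"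

lemma column_gram_mult_outside: "a \<notin> S \<Longrightarrow> (column_gram A S *v x) $ a = x $ a"
  by (simp add: column_gram_def matrix_vector_mult_def if_distrib[of "\<lambda>r. r * _"] cong: if_cong)

lemma column_gram_mult_inside:
  assumes a: "a \<in> S" and x: "\<And>b. b \<notin> S \<Longrightarrow> x $ b = 0"
  shows "(column_gram A S *v x) $ a = (transpose A *v (A *v x)) $ a"
proof -
  have "(column_gram A S *v x) $ a = (\<Sum>b\<in>UNIV. (\<Sum>m\<in>UNIV. A $ m $ a * A $ m $ b) * x $ b)"
    using a x by (auto simp: column_gram_def matrix_vector_mult_def intro!: sum.cong)
  also have "\<dots> = (transpose A *v (A *v x)) $ a"
    unfolding matrix_vector_mult_def transpose_def
    by (simp add: sum_distrib_left sum_distrib_right mult.assoc) (rule sum.swap)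
  finally show ?thesis .
qed

lemma det_nonzero_iff: "det A \<noteq> 0 \<longleftrightarrow> (\<forall>x. A *v x = 0 \<longrightarrow> x = 0)" for A :: "real^'n^'n"
  by (metis invertible_det_nz invertible_left_inverse matrix_left_invertible_ker)

text \<open>A nonsingular Gram matrix makes \<open>A\<close> injective on the vectors supported in
  \<open>S\<close>.\<close>

lemma rank_ge_card_if_gram:
  fixes A :: "real^'n^'m"
  assumes "det (column_gram A S) \<noteq> 0"
  shows "card S \<le> rank A"
proof -
  let ?V = "{x :: real^'n. \<forall>i. i \<notin> S \<longrightarrow> x $ i = 0}"
  have V: "subspace ?V" by (auto simp: subspace_def)
  have "inj_on ((*v) A) ?V"
  proof (subst linear_inj_on_iff_eq_0[OF matrix_vector_mul_linear V], intro ballI impI)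
    fix x assume x: "x \<in> ?V" "A *v x = 0"
    have "(column_gram A S *v x) $ a = 0" for a
      using column_gram_mult_inside[of a S x A] column_gram_mult_outside[of a S A x] x
      by (cases "a \<in> S") auto
    then have "column_gram A S *v x = 0" by (simp add: vec_eq_iff)
    then show "x = 0" using assms det_nonzero_iff by blast
  qed
  then have "dim ((*v) A ` ?V) = dim ?V"
    using V by (intro dim_image_eq matrix_vector_mul_linear) (simp add: span_eq_iff[THEN iffD2])
  moreover have "dim ?V = card S"
    using dim_substandard_cart[where 'a = real, of S] by (simp add: dim_vec_eq)
  moreover have "dim ((*v) A ` ?V) \<le> rank A"
    unfolding rank_dim_range by (intro dim_subset) auto
  ultimately show ?thesis by simp
qed

lemma exists_gram_of_rank:
  fixes A :: "real^'n^'m"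
  shows "\<exists>S. card S = rank A \<and> det (column_gram A S) \<noteq> 0"
proof -
  obtain B where B: "B \<subseteq> columns A" "independent B" "card B = dim (columns A)"
    by (rule basis_exists[of "columns A"])
  \<comment> \<open>Columns may coincide, so one index is chosen for each basis vector.\<close>
  define idx where "idx b = (SOME i. column i A = b)" for b
  have idx: "column (idx b) A = b" if "b \<in> B" for b
    unfolding idx_def using B(1) that by (intro someI_ex[of "\<lambda>i. column i A = b"]) (auto simp: columns_def)
  have inj: "inj_on idx B" by (metis idx inj_onI)
  have "det (column_gram A (idx ` B)) \<noteq> 0"
    unfolding det_nonzero_iff
  proof (intro allI impI)
    fix x assume x: "column_gram A (idx ` B) *v x = 0"
    have outside: "x $ a = 0" if "a \<notin> idx ` B" for a
      using column_gram_mult_outside[OF that, of A x] x by simp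
    have inside: "(transpose A *v (A *v x)) $ a = 0" if "a \<in> idx ` B" for a
      using column_gram_mult_inside[OF that outside, of A] x by simp
    \<comment> \<open>The norm of \<open>A *v x\<close> vanishes, because \<open>x\<close> is zero
      off the chosen columns and the transpose product is zero on them.\<close>
    have "(A *v x) \<bullet> (A *v x) = x \<bullet> (transpose A *v (A *v x))"
      using dot_lmul_matrix[of "A *v x" A x] by (simp add: inner_commute)
    also have "\<dots> = 0"
    proof -
      have "x $ a * (transpose A *v (A *v x)) $ a = 0" for a
        using inside[of a] outside[of a] by (cases "a \<in> idx ` B") auto
      then show ?thesis unfolding inner_vec_def inner_real_def by (intro sum.neutral) blast
    qed
    finally have "A *v x = 0" by simp
    then have "0 = (\<Sum>i\<in>UNIV. x $ i *\<^sub>R column i A)"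
      by (simp add: matrix_mult_sum scalar_mult_eq_scaleR)
    also have "\<dots> = (\<Sum>i\<in>idx ` B. x $ i *\<^sub>R column i A)"
      using outside by (intro sum.mono_neutral_right) auto
    also have "\<dots> = (\<Sum>b\<in>B. x $ idx b *\<^sub>R b)"
      using inj idx by (simp add: sum.reindex)
    finally have "(\<Sum>b\<in>B. x $ idx b *\<^sub>R b) = 0" ..
    then have "x $ idx b = 0" if "b \<in> B" for b
      using independentD[OF B(2) independent_imp_finite[OF B(2)] subset_refl, of "\<lambda>b. x $ idx b" b] that
      by simp
    then have "x $ a = 0" for a using outside[of a] by (cases "a \<in> idx ` B") auto
    then show "x = 0" by (simp add: vec_eq_iff)
  qed
  then show ?thesis
    using B(3) inj column_rank_def[of A] by (metis card_image)
qed

text \<open>A Gram determinant witnessing the rank at \<open>q\<close> is a polynomial that is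
  nonzero at \<open>q\<close>, so it cannot vanish at \<open>p\<close>.\<close>

lemma rank_le_of_free_motion:
  fixes A :: "('v::finite \<Rightarrow> real^3) \<Rightarrow> real^'n^'m"
  assumes p: "free_motion p" and q: "on_cylinder q"
    and A: "\<And>i j. polynomial_fun (\<lambda>c. A c $ i $ j)"
  shows "rank (A q) \<le> rank (A p)"
proof -
  obtain S where S: "card S = rank (A q)" "det (column_gram (A q) S) \<noteq> 0"
    using exists_gram_of_rank by blast
  have "polynomial_fun (\<lambda>c. column_gram (A c) S $ a $ b)" for a b
  proof -
    consider "a \<in> S \<and> b \<in> S" | "\<not> (a \<in> S \<and> b \<in> S)" by blast
    then show ?thesis
    proof cases
      case 1
      then show ?thesis
        by (auto simp: column_gram_def intro!: polynomial_fun_sum polynomial_fun_mult A)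
    next
      case 2
      then show ?thesis
        using polynomial_fun_of_int[of 0] polynomial_fun_of_int[of 1] by (auto simp: column_gram_def)
    qed
  qed
  then obtain f where f: "\<And>c. det (column_gram (A c) S) = cpoly_at_conf c f"
    using polynomial_fun_det[of "\<lambda>c. column_gram (A c) S"] by (auto simp: polynomial_fun_def)
  have "det (column_gram (A p) S) \<noteq> 0"
    using cpoly_vanishes_everywhere[OF p _ q, of f] S(2) by (auto simp: f)
  then show ?thesis using rank_ge_card_if_gram[of "A p" S] S(1) by simp
qed

section \<open>Stresses and flexes\<close>

lemma dist_squared_3: "(dist a b)\<^sup>2 = (a $ 1 - b $ 1)\<^sup>2 + (a $ 2 - b $ 2)\<^sup>2 + (a $ 3 - b $ 3)\<^sup>2"
  for a b :: "real^3"
  by (simp add: dist_vec_def L2_set_def sum_3 dist_real_def)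

text \<open>On the cylinder \<open>cross2 c i j\<close> and \<open>dot2 c i j\<close> are the sine
  and cosine of the angle of \<open>i\<close> minus that of \<open>j\<close>.\<close>

definition cross2 :: "('v \<Rightarrow> real^3) \<Rightarrow> 'v \<Rightarrow> 'v \<Rightarrow> real" where
  "cross2 c i j = c j $ 1 * c i $ 2 - c j $ 2 * c i $ 1"

definition dot2 :: "('v \<Rightarrow> real^3) \<Rightarrow> 'v \<Rightarrow> 'v \<Rightarrow> real" where
  "dot2 c i j = c i $ 1 * c j $ 1 + c i $ 2 * c j $ 2"

text \<open>Half the rate of change of the squared distance, see
  \<open>derivation_dist_squared\<close>.\<close>

definition strain :: "('v \<Rightarrow> real^3) \<Rightarrow> ('v \<Rightarrow> real) \<Rightarrow> ('v \<Rightarrow> real) \<Rightarrow> 'v \<Rightarrow> 'v \<Rightarrow> real" where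
  "strain c \<alpha> \<zeta> i j = cross2 c i j * (\<alpha> i - \<alpha> j) + (c i $ 3 - c j $ 3) * (\<zeta> i - \<zeta> j)"

lemma cross2_swap: "cross2 c j i = - cross2 c i j"
  by (simp add: cross2_def)

lemma dist_squared_on_cylinder:
  assumes "on_cylinder c"
  shows "(dist (c i) (c j))\<^sup>2 = 2 - 2 * dot2 c i j + (c i $ 3 - c j $ 3)\<^sup>2"
  using on_cylinderD[OF assms, of i] on_cylinderD[OF assms, of j]
  unfolding dist_squared_3 dot2_def by algebra

lemma derivation_dist_squared:
  assumes "moves D c \<alpha> \<zeta>"
  shows "D ((dist (c i) (c j))\<^sup>2) = 2 * strain c \<alpha> \<zeta> i j"
proof -
  have D: "derivation D" and v: "\<And>v. D (c v $ 1) = - (\<alpha> v * c v $ 2)"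
    "\<And>v. D (c v $ 2) = \<alpha> v * c v $ 1" "\<And>v. D (c v $ 3) = \<zeta> v"
    using assms by (auto simp: moves_def)
  show ?thesis
    unfolding dist_squared_3 strain_def cross2_def
    by (simp add: derivation_simps[OF D] v algebra_simps)
qed

lemma derivation_cross2:
  assumes "moves D c \<alpha> \<zeta>"
  shows "D (cross2 c i j) = (\<alpha> i - \<alpha> j) * dot2 c i j"
proof -
  have D: "derivation D" and v: "\<And>v. D (c v $ 1) = - (\<alpha> v * c v $ 2)"
    "\<And>v. D (c v $ 2) = \<alpha> v * c v $ 1"
    using assms by (auto simp: moves_def)
  show ?thesis
    unfolding cross2_def dot2_def
    by (simp add: derivation_simps[OF D] v algebra_simps)
qed

text \<open>Rows range over all ordered pairs, with zero rows off \<open>E\<close>, so that the type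
  does not depend on \<open>E\<close>; \<open>Inl\<close> columns are angular, \<open>Inr\<close>
  columns vertical. The \<open>of_int\<close> terms make each entry visibly a polynomial with
  integer coefficients.\<close>

definition rigidity_matrix :: "'v::finite set set \<Rightarrow> ('v \<Rightarrow> real^3) \<Rightarrow> real^('v + 'v)^('v \<times> 'v)" where
  "rigidity_matrix E c = (\<chi> e s. if {fst e, snd e} \<in> E
     then (case s of
         Inl v \<Rightarrow> cross2 c (fst e) (snd e) * (of_int (of_bool (fst e = v)) - of_int (of_bool (snd e = v)))
       | Inr v \<Rightarrow> (c (fst e) $ 3 - c (snd e) $ 3) * (of_int (of_bool (fst e = v)) - of_int (of_bool (snd e = v))))
     else of_int 0)"

lemma sum_UNIV_sum: "(\<Sum>s\<in>UNIV. f s) = (\<Sum>a\<in>UNIV. f (Inl a)) + (\<Sum>b\<in>UNIV. f (Inr b))"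
  for f :: "'a::finite + 'b::finite \<Rightarrow> 'c::comm_monoid_add"
  by (subst UNIV_Plus_UNIV[symmetric], subst sum.Plus) (simp_all add: comp_def)

lemma rigidity_matrix_mult:
  "(rigidity_matrix E c *v x) $ (i, j) =
     (if {i, j} \<in> E then strain c (\<lambda>v. x $ Inl v) (\<lambda>v. x $ Inr v) i j else 0)"
proof -
  have *: "(\<Sum>v\<in>UNIV. a * (of_bool (i = v) - of_bool (j = v)) * f v) = a * (f i - f j)"
    for a and f :: "'a \<Rightarrow> real"
  proof -
    have "(\<Sum>v\<in>UNIV. a * (of_bool (i = v) - of_bool (j = v)) * f v)
        = a * (\<Sum>v\<in>UNIV. (if i = v then f v else 0) - (if j = v then f v else 0))"
      unfolding sum_distrib_left by (intro sum.cong) auto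
    then show ?thesis by (simp add: sum_subtractf)
  qed
  show ?thesis
    by (simp add: matrix_vector_mult_def rigidity_matrix_def sum_UNIV_sum strain_def *)
qed

lemma polynomial_fun_rigidity_matrix: "polynomial_fun (\<lambda>c. rigidity_matrix E c $ e $ s)"
proof -
  have "polynomial_fun (\<lambda>c. if {fst e, snd e} \<in> E then F c else of_int 0)"
    if "polynomial_fun F" for F :: "('a \<Rightarrow> real^3) \<Rightarrow> real"
    using that polynomial_fun_of_int[of 0] by (cases "{fst e, snd e} \<in> E") simp_all
  note intros = this polynomial_fun_mult polynomial_fun_diff polynomial_fun_of_int polynomial_fun_coordinate
  show ?thesis
    unfolding rigidity_matrix_def cross2_def
    by (cases s; simp only: vec_lambda_beta sum.case; intro intros)
qed

text \<open>Both sides are half of \<open>D\<close> applied to the same squared edge length.\<close>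

lemma equivalent_frameworks_strain:
  assumes eqv: "equivalent_frameworks E p q" and p: "moves D p \<alpha> \<zeta>" and q: "moves D q \<alpha>' \<zeta>'"
    and e: "{i, j} \<in> E"
  shows "strain p \<alpha> \<zeta> i j = strain q \<alpha>' \<zeta>' i j"
  using derivation_dist_squared[OF p, of i j] derivation_dist_squared[OF q, of i j] eqv e
  by (simp add: equivalent_frameworks_def)

lemma range_rigidity_matrix_eq:
  assumes p: "free_motion p" and q: "on_cylinder q" and eqv: "equivalent_frameworks E p q"
  shows "range ((*v) (rigidity_matrix E p)) = range ((*v) (rigidity_matrix E q))"
proof (rule subspace_dim_equal)
  show "range ((*v) (rigidity_matrix E p)) \<subseteq> range ((*v) (rigidity_matrix E q))"
  proof
    fix y assume "y \<in> range ((*v) (rigidity_matrix E p))"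
    then obtain x where y: "y = rigidity_matrix E p *v x" by blast
    obtain D where D: "moves D p (\<lambda>v. x $ Inl v) (\<lambda>v. x $ Inr v)"
      using p by (auto simp: free_motion_def)
    then have "derivation D" by (simp add: moves_def)
    \<comment> \<open>\<open>D\<close> is defined on all reals, so it acts on the coordinates of
      \<open>q\<close> whatever their relation to those of \<open>p\<close>.\<close>
    from moves_of_derivation[OF this q] obtain \<alpha> \<zeta> where Dq: "moves D q \<alpha> \<zeta>" ..
    have "y = rigidity_matrix E q *v (\<chi> s. case s of Inl v \<Rightarrow> \<alpha> v | Inr v \<Rightarrow> \<zeta> v)"
      using equivalent_frameworks_strain[OF eqv D Dq]
      by (auto simp: vec_eq_iff y rigidity_matrix_mult)
    then show "y \<in> range ((*v) (rigidity_matrix E q))" by simp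
  qed
  have "rank (rigidity_matrix E q) \<le> rank (rigidity_matrix E p)"
    by (rule rank_le_of_free_motion[OF p q polynomial_fun_rigidity_matrix])
  then show "dim (range ((*v) (rigidity_matrix E q))) \<le> dim (range ((*v) (rigidity_matrix E p)))"
    by (simp add: rank_dim_range)
qed (auto intro: linear_subspace_image matrix_vector_mul_linear)

section \<open>Tangential equilibrium and virtual work\<close>

definition tangential_equilibrium :: "('v::finite \<Rightarrow> real^3) \<Rightarrow> ('v \<Rightarrow> 'v \<Rightarrow> real) \<Rightarrow> bool" where
  "tangential_equilibrium c w \<longleftrightarrow>
     (\<forall>i. (\<Sum>j\<in>UNIV. w i j * cross2 c i j) = 0 \<and> (\<Sum>j\<in>UNIV. w i j * (c i $ 3 - c j $ 3)) = 0)"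

lemma sum_antisymmetric:
  fixes g :: "'v::finite \<Rightarrow> 'v \<Rightarrow> real"
  assumes "\<And>i j. g j i = - g i j"
  shows "(\<Sum>i\<in>UNIV. \<Sum>j\<in>UNIV. g i j * (f i - f j)) = 2 * (\<Sum>i\<in>UNIV. f i * (\<Sum>j\<in>UNIV. g i j))"
proof -
  have "(\<Sum>i\<in>UNIV. \<Sum>j\<in>UNIV. g i j * f j) = (\<Sum>i\<in>UNIV. \<Sum>j\<in>UNIV. g j i * f i)"
    by (rule sum.swap)
  also have "\<dots> = - (\<Sum>i\<in>UNIV. \<Sum>j\<in>UNIV. f i * g i j)"
  proof -
    have "g j i * f i = - (f i * g i j)" for i j
      by (subst assms) simp
    then show ?thesis by (simp only: sum_negf)
  qed
  finally show ?thesis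
    by (simp add: right_diff_distrib sum_subtractf sum_distrib_left mult.commute)
qed

text \<open>Principle of virtual work: equilibrium is orthogonality to all strains. For weights
  supported on edges this depends only on the range of the rigidity matrix.\<close>

lemma tangential_equilibrium_iff:
  fixes w :: "'v::finite \<Rightarrow> 'v \<Rightarrow> real"
  assumes sym: "\<And>i j. w i j = w j i"
  shows "tangential_equilibrium c w \<longleftrightarrow>
    (\<forall>\<alpha> \<zeta>. (\<Sum>i\<in>UNIV. \<Sum>j\<in>UNIV. w i j * strain c \<alpha> \<zeta> i j) = 0)"
proof -
  have virtual_work: "(\<Sum>i\<in>UNIV. \<Sum>j\<in>UNIV. w i j * strain c \<alpha> \<zeta> i j) =
      2 * (\<Sum>i\<in>UNIV. \<alpha> i * (\<Sum>j\<in>UNIV. w i j * cross2 c i j)) +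
      2 * (\<Sum>i\<in>UNIV. \<zeta> i * (\<Sum>j\<in>UNIV. w i j * (c i $ 3 - c j $ 3)))" for \<alpha> \<zeta>
  proof -
    have "w j i * cross2 c j i = - (w i j * cross2 c i j)"
      "w j i * (c j $ 3 - c i $ 3) = - (w i j * (c i $ 3 - c j $ 3))" for i j
      by (simp_all add: sym[of j i] cross2_swap[of c j i] algebra_simps)
    from sum_antisymmetric[of "\<lambda>i j. w i j * cross2 c i j" \<alpha>, OF this(1)]
      sum_antisymmetric[of "\<lambda>i j. w i j * (c i $ 3 - c j $ 3)" \<zeta>, OF this(2)]
    show ?thesis
      by (simp add: strain_def distrib_left sum.distrib mult.assoc)
  qed
  show ?thesis
  proof
    assume "tangential_equilibrium c w"
    then show "\<forall>\<alpha> \<zeta>. (\<Sum>i\<in>UNIV. \<Sum>j\<in>UNIV. w i j * strain c \<alpha> \<zeta> i j) = 0"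
      unfolding virtual_work by (simp add: tangential_equilibrium_def)
  next
    assume work: "\<forall>\<alpha> \<zeta>. (\<Sum>i\<in>UNIV. \<Sum>j\<in>UNIV. w i j * strain c \<alpha> \<zeta> i j) = 0"
    show "tangential_equilibrium c w"
      unfolding tangential_equilibrium_def
    proof
      fix v
      show "(\<Sum>j\<in>UNIV. w v j * cross2 c v j) = 0 \<and> (\<Sum>j\<in>UNIV. w v j * (c v $ 3 - c j $ 3)) = 0"
        using work[unfolded virtual_work, rule_format, of "\<lambda>i. if i = v then 1 else 0" "\<lambda>i. 0"]
          work[unfolded virtual_work, rule_format, of "\<lambda>i. 0" "\<lambda>i. if i = v then 1 else 0"]
        by (simp add: if_distrib[of "\<lambda>r. r * _"] cong: if_cong)
    qed
  qed
qed

lemma tangential_equilibrium_transfer: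
  fixes w :: "'v::finite \<Rightarrow> 'v \<Rightarrow> real"
  assumes p: "free_motion p" and q: "on_cylinder q" and eqv: "equivalent_frameworks E p q"
    and sym: "\<And>i j. w i j = w j i" and edge: "\<And>i j. {i, j} \<notin> E \<Longrightarrow> w i j = 0"
    and w: "tangential_equilibrium p w"
  shows "tangential_equilibrium q w"
  unfolding tangential_equilibrium_iff[OF sym]
proof (intro allI)
  fix \<alpha> \<zeta> :: "'v \<Rightarrow> real"
  let ?x = "\<chi> s. case s of Inl v \<Rightarrow> \<alpha> v | Inr v \<Rightarrow> \<zeta> v"
  obtain y where y: "rigidity_matrix E q *v ?x = rigidity_matrix E p *v y"
    using range_rigidity_matrix_eq[OF p q eqv] by blast
  have "w i j * strain q \<alpha> \<zeta> i j = w i j * strain p (\<lambda>v. y $ Inl v) (\<lambda>v. y $ Inr v) i j" for i j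
  proof (cases "{i, j} \<in> E")
    case True
    then show ?thesis
      using arg_cong[OF y, of "\<lambda>u. u $ (i, j)"] unfolding rigidity_matrix_mult by simp
  qed (simp add: edge)
  then show "(\<Sum>i\<in>UNIV. \<Sum>j\<in>UNIV. w i j * strain q \<alpha> \<zeta> i j) = 0"
    using w unfolding tangential_equilibrium_iff[OF sym] by (simp only:)
qed

section \<open>Nondegeneracy of free configurations\<close>

lemma free_motion_height_distinct:
  assumes free: "free_motion p" and "i \<noteq> j" shows "p i $ 3 \<noteq> p j $ 3"
proof
  assume eq: "p i $ 3 = p j $ 3"
  \<comment> \<open>Raising \<open>i\<close> alone would turn the equality into 1 = 0.\<close>
  obtain D where "moves D p (\<lambda>v. 0) (\<lambda>v. if v = i then 1 else 0)" using free by (auto simp: free_motion_def)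
  then have "D (p i $ 3) = 1" "D (p j $ 3) = 0" using \<open>i \<noteq> j\<close> by (auto simp: moves_def)
  then show False using eq by simp
qed

text \<open>Turning \<open>i\<close> alone differentiates the sine to the cosine, and the two cannot
  both vanish.\<close>

lemma free_motion_cross2_nonzero:
  assumes free: "free_motion p" and "i \<noteq> j" shows "cross2 p i j \<noteq> 0"
proof
  have cylinder: "on_cylinder p" using free by (simp add: free_motion_def)
  assume eq: "cross2 p i j = 0"
  obtain D where D: "moves D p (\<lambda>v. if v = i then 1 else 0) (\<lambda>v. 0)" using free by (auto simp: free_motion_def)
  then have "dot2 p i j = 0"
    using derivation_cross2[OF D, of i j] eq \<open>i \<noteq> j\<close> by (simp add: moves_def derivation_0)
  moreover have "(cross2 p i j)\<^sup>2 + (dot2 p i j)\<^sup>2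
      = ((p i $ 1)\<^sup>2 + (p i $ 2)\<^sup>2) * ((p j $ 1)\<^sup>2 + (p j $ 2)\<^sup>2)"
    unfolding cross2_def dot2_def by algebra
  ultimately show False
    using eq on_cylinderD[OF cylinder, of i] on_cylinderD[OF cylinder, of j] by simp
qed

lemma free_motion_affine_height_zero:
  assumes "free_motion p" "i \<noteq> j" "a + b * p i $ 3 = 0" "a + b * p j $ 3 = 0"
  shows "a = 0 \<and> b = 0"
proof -
  have "b * (p i $ 3 - p j $ 3) = (a + b * p i $ 3) - (a + b * p j $ 3)"
    by (simp add: algebra_simps)
  then have "b = 0" using free_motion_height_distinct[OF assms(1,2)] assms(3,4) by simp
  then show ?thesis using assms(3) by simp
qed

lemma linear_noninjective:
  fixes f :: "'a::euclidean_space \<Rightarrow> 'b::euclidean_space"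
  assumes "linear f" "DIM('b) < DIM('a)"
  shows "\<exists>x. x \<noteq> 0 \<and> f x = 0"
proof (rule ccontr)
  assume "\<not> ?thesis"
  then have "inj f" using linear_injective_0[OF assms(1)] by blast
  then have "DIM('a) = dim (range f)"
    using dim_image_eq[OF assms(1), of UNIV] by simp
  then show False using dim_subset_UNIV[of "range f"] assms(2) by simp
qed

text \<open>\<open>w\<close> is the stress extended by zero to all pairs. The two kernel assumptions
  express maximality of the rank block by block; two vertices are treated separately in the final
  proof.\<close>

locale max_rank_stressed_framework =
  fixes E :: "'v::finite set set" and p :: "'v \<Rightarrow> real^3" and w :: "'v \<Rightarrow> 'v \<Rightarrow> real" and l :: "'v \<Rightarrow> real"
  assumes free: "free_motion p"
    and sym: "\<And>i j. w i j = w j i"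
    and edge: "\<And>i j. {i, j} \<notin> E \<Longrightarrow> w i j = 0"
    and equilibrium_x: "\<And>i. (\<Sum>j\<in>UNIV. w i j * (p i $ 1 - p j $ 1)) + l i * p i $ 1 = 0"
    and equilibrium_y: "\<And>i. (\<Sum>j\<in>UNIV. w i j * (p i $ 2 - p j $ 2)) + l i * p i $ 2 = 0"
    and equilibrium_z: "\<And>i. (\<Sum>j\<in>UNIV. w i j * (p i $ 3 - p j $ 3)) = 0"
    and vertical_kernel: "\<And>f. (\<And>i. (\<Sum>j\<in>UNIV. w i j * (f i - f j)) = 0)
      \<Longrightarrow> \<exists>a b. \<forall>i. f i = a + b * p i $ 3"
    and horizontal_kernel: "\<And>f. (\<And>i. (\<Sum>j\<in>UNIV. w i j * (f i - f j)) + l i * f i = 0)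
      \<Longrightarrow> \<exists>a b. \<forall>i. f i = a * p i $ 1 + b * p i $ 2"
    and card_ge_3: "3 \<le> CARD('v)"
begin

lemma cylinder: "on_cylinder p"
  using free by (simp add: free_motion_def)

lemma obtain_motion:
  obtains D where "moves D p \<alpha> \<zeta>"
  using free by (auto simp: free_motion_def)

lemma obtain_third:
  obtains k :: 'v where "k \<noteq> i" "k \<noteq> j"
proof -
  have "\<not> (UNIV :: 'v set) \<subseteq> {i, j}"
    using card_ge_3 card_mono[of "{i, j}" "UNIV :: 'v set"] card_insert_le_m1[of 2 "{j}" i]
    by (auto simp: card_insert_if split: if_splits)
  then show ?thesis using that by blast
qed

lemmas height_distinct = free_motion_height_distinct[OF free]
  and cross2_nonzero = free_motion_cross2_nonzero[OF free]
  and affine_height_zero = free_motion_affine_height_zero[OF free]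

text \<open>If \<open>w\<close> vanished, every function would be affine in the heights, but the
  indicator of one vertex vanishes at two others.\<close>

lemma exists_stressed_edge: "\<exists>i j. i \<noteq> j \<and> w i j \<noteq> 0"
proof (rule ccontr)
  assume "\<not> ?thesis"
  then have zero: "w i j * (f i - f j) = 0" for i j and f :: "'v \<Rightarrow> real"
    by (cases "i = j") auto
  obtain i j :: 'v where ij: "j \<noteq> i" by (rule obtain_third)
  obtain k where k: "k \<noteq> i" "k \<noteq> j" by (rule obtain_third)
  obtain a b where ab: "\<And>v. (if v = i then 1 else 0) = a + b * p v $ 3"
  proof -
    have "\<exists>a b. \<forall>v. (if v = i then 1 else 0) = a + b * p v $ 3"
      by (intro vertical_kernel sum.neutral ballI zero)
    then show ?thesis using that by auto
  qed
  have "a = 0 \<and> b = 0"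
    using affine_height_zero[of j k a b] ab[of j] ab[of k] ij k by simp
  then show False using ab[of i] by simp
qed

text \<open>The graph is connected: such an \<open>f\<close> is in the vertical kernel, hence affine
  in the heights, and a stressed edge joins two different heights.\<close>

lemma edgewise_constant:
  fixes f :: "'v \<Rightarrow> real"
  assumes "\<And>i j. {i, j} \<in> E \<Longrightarrow> f i = f j"
  shows "\<exists>a. \<forall>i. f i = a"
proof -
  have "w i j * (f i - f j) = 0" for i j using assms[of i j] edge[of i j] by auto
  then obtain a b where ab: "\<And>v. f v = a + b * p v $ 3"
    using vertical_kernel[of f, OF sum.neutral] by auto
  obtain i j where ij: "i \<noteq> j" "w i j \<noteq> 0" using exists_stressed_edge by blast
  then have "b * p i $ 3 = b * p j $ 3" using assms[of i j] edge ab by force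
  then have "b = 0" using height_distinct[OF ij(1)] by simp
  then show ?thesis using ab by auto
qed

text \<open>Taking the horizontal cross product with \<open>p i\<close> removes the radial term in
  \<open>l\<close>.\<close>

lemma tangential: "tangential_equilibrium p w"
  unfolding tangential_equilibrium_def
proof (intro allI conjI equilibrium_z)
  fix i
  have "(\<Sum>j\<in>UNIV. w i j * cross2 p i j)
      = p i $ 1 * (\<Sum>j\<in>UNIV. w i j * (p i $ 2 - p j $ 2)) - p i $ 2 * (\<Sum>j\<in>UNIV. w i j * (p i $ 1 - p j $ 1))"
    unfolding sum_distrib_left sum_subtractf[symmetric] cross2_def
    by (intro sum.cong) (auto simp: algebra_simps)
  also have "\<dots> = p i $ 1 * (- l i * p i $ 2) - p i $ 2 * (- l i * p i $ 1)"
  proof -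
    have "(\<Sum>j\<in>UNIV. w i j * (p i $ 1 - p j $ 1)) = - l i * p i $ 1"
      "(\<Sum>j\<in>UNIV. w i j * (p i $ 2 - p j $ 2)) = - l i * p i $ 2"
      using equilibrium_x[of i] equilibrium_y[of i] by linarith+
    then show ?thesis by simp
  qed
  finally show "(\<Sum>j\<in>UNIV. w i j * cross2 p i j) = 0" by simp
qed

text \<open>With three vertices, equilibrium at an end \<open>i\<close> of a stressed edge
  \<open>i j\<close> gives a relation between the directions of \<open>i j\<close> and
  \<open>i k\<close>; raising \<open>k\<close> alone breaks it. The bound makes n + 3 < 2n in
  \<open>height_scaling\<close>.\<close>

lemma card_ge_4: "4 \<le> CARD('v)"
proof (rule ccontr)
  assume "\<not> 4 \<le> CARD('v)"
  then have card: "CARD('v) = 3" using card_ge_3 by simp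
  obtain i j where ij: "i \<noteq> j" "w i j \<noteq> 0" using exists_stressed_edge by blast
  obtain k where k: "k \<noteq> i" "k \<noteq> j" by (rule obtain_third)
  have "{i, j, k} = UNIV"
    using ij k card by (intro card_subset_eq) auto
  then have sum: "(\<Sum>v\<in>UNIV. g v) = g i + g j + g k" for g :: "'v \<Rightarrow> real"
    unfolding \<open>{i, j, k} = UNIV\<close>[symmetric] using ij k by (simp add: add.assoc)
  have "w i j * cross2 p i j + w i k * cross2 p i k = 0"
    using tangential[unfolded tangential_equilibrium_def, THEN spec, of i] unfolding sum
    by (simp add: cross2_def mult.commute)
  moreover have "w i j * (p i $ 3 - p j $ 3) + w i k * (p i $ 3 - p k $ 3) = 0"
    using equilibrium_z[of i] unfolding sum by simp
  ultimately have "w i j * (cross2 p i j * (p i $ 3 - p k $ 3)) = w i j * (cross2 p i k * (p i $ 3 - p j $ 3))"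
    by algebra
  then have eq: "cross2 p i j * (p i $ 3 - p k $ 3) = cross2 p i k * (p i $ 3 - p j $ 3)"
    using ij by simp
  obtain D where D: "moves D p (\<lambda>v. 0) (\<lambda>v. if v = k then 1 else 0)" by (rule obtain_motion)
  then have der: "derivation D" and z: "\<And>v. D (p v $ 3) = (if v = k then 1 else 0)"
    by (auto simp: moves_def)
  have "cross2 p i j = 0"
    using arg_cong[OF eq, of D] k ij(1)
    by (simp add: derivation_simps[OF der] z derivation_cross2[OF D])
  then show False using cross2_nonzero[OF ij(1)] by simp
qed

text \<open>If \<open>D\<close> kills the edge lengths, then so does the part \<open>D' \<circ> D\<close> of the commutator, so the
  space of tangential stresses is stable under \<open>D\<close>. Hence differentiating the vertical
  equilibrium of \<open>w\<close> leaves only the term in \<open>\<zeta>\<close>.\<close>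
lemma flex_heights_affine:
  assumes D: "moves D p \<alpha> \<zeta>" and flex: "\<And>i j. {i, j} \<in> E \<Longrightarrow> strain p \<alpha> \<zeta> i j = 0"
  shows "\<exists>a b. \<forall>i. \<zeta> i = a + b * p i $ 3"
proof -
  let ?f = "\<lambda>i j. (dist (p i) (p j))\<^sup>2"
  have der: "derivation D" using D by (simp add: moves_def)
  have work: "(\<Sum>i\<in>UNIV. \<Sum>j\<in>UNIV. w i j * D' (?f i j)) = 0" if "moves D' p \<beta> \<eta>" for D' \<beta> \<eta>
  proof -
    have "(\<Sum>i\<in>UNIV. \<Sum>j\<in>UNIV. w i j * D' (?f i j))
        = 2 * (\<Sum>i\<in>UNIV. \<Sum>j\<in>UNIV. w i j * strain p \<beta> \<eta> i j)"
      by (simp add: derivation_dist_squared[OF that] sum_distrib_left mult_ac)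
    then show ?thesis using tangential tangential_equilibrium_iff[of w, OF sym] by simp
  qed
  have "tangential_equilibrium p (\<lambda>i j. D (w i j))"
  proof (subst tangential_equilibrium_iff, simp add: sym, intro allI)
    fix \<beta> \<eta>
    obtain D' where D': "moves D' p \<beta> \<eta>" by (rule obtain_motion)
    then have der': "derivation D'" by (simp add: moves_def)
    have commutator: "w i j * (D (D' (?f i j)) - D' (D (?f i j))) = w i j * D (D' (?f i j))" for i j
    proof (cases "{i, j} \<in> E")
      case True
      then show ?thesis
        using flex by (simp add: derivation_dist_squared[OF D] derivation_0[OF der'])
    qed (simp add: edge)
    \<comment> \<open>The commutator is itself a derivation, so it moves \<open>p\<close> along the
      cylinder and \<open>w\<close> does no work on it.\<close>
    have "(\<Sum>i\<in>UNIV. \<Sum>j\<in>UNIV. w i j * (D (D' (?f i j)) - D' (D (?f i j)))) = 0"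
      by (rule work[OF moves_of_derivation[OF derivation_commutator[OF der der'] cylinder]])
    then have "(\<Sum>i\<in>UNIV. \<Sum>j\<in>UNIV. w i j * D (D' (?f i j))) = 0"
      unfolding commutator .
    moreover have "0 = D (\<Sum>i\<in>UNIV. \<Sum>j\<in>UNIV. w i j * D' (?f i j))"
      unfolding work[OF D'] by (simp add: derivation_0[OF der])
    ultimately have "(\<Sum>i\<in>UNIV. \<Sum>j\<in>UNIV. D (w i j) * D' (?f i j)) = 0"
      by (simp add: derivation_sum[OF der] derivation_mult[OF der] sum.distrib)
    then have "2 * (\<Sum>i\<in>UNIV. \<Sum>j\<in>UNIV. D (w i j) * strain p \<beta> \<eta> i j) = 0"
      unfolding derivation_dist_squared[OF D'] by (simp add: sum_distrib_left mult_ac)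
    then show "(\<Sum>i\<in>UNIV. \<Sum>j\<in>UNIV. D (w i j) * strain p \<beta> \<eta> i j) = 0" by simp
  qed
  then have "(\<Sum>j\<in>UNIV. D (w i j) * (p i $ 3 - p j $ 3)) = 0" for i
    by (simp add: tangential_equilibrium_def)
  moreover have "0 = D (\<Sum>j\<in>UNIV. w i j * (p i $ 3 - p j $ 3))" for i
    unfolding equilibrium_z by (simp add: derivation_0[OF der])
  ultimately have "(\<Sum>j\<in>UNIV. w i j * (\<zeta> i - \<zeta> j)) = 0" for i
    using D by (simp add: derivation_simps[OF der] sum.distrib moves_def)
  then show ?thesis by (rule vertical_kernel)
qed

end

section \<open>Comparison with a realisation of equal edge lengths\<close>

locale equivalent_realisation = max_rank_stressed_framework E p w l
  for E :: "'v::finite set set" and p w l +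
  fixes q :: "'v \<Rightarrow> real^3"
  assumes q: "on_cylinder q" and eqv: "equivalent_frameworks E p q"
begin

lemma tangential_q: "tangential_equilibrium q w"
  by (rule tangential_equilibrium_transfer[where w = w, OF free q eqv sym edge tangential])

lemma heights_affine: "\<exists>a b. \<forall>i. q i $ 3 = a + b * p i $ 3"
  using tangential_q by (intro vertical_kernel) (simp add: tangential_equilibrium_def)

text \<open>Suppose that the scaling factor \<open>b\<close> of the heights is not \<open>\<plusminus>1\<close>. A motion of \<open>p\<close> along which \<open>b\<close> is
  constant and \<open>q\<close> only rotates becomes a flex of \<open>p\<close> after scaling its vertical part by \<open>1 - b\<^sup>2\<close>.
  These are only \<open>n\<close> conditions, so there are too many such flexes.\<close>
lemma height_scaling:
  assumes b: "\<And>i. q i $ 3 = a + b * p i $ 3"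
  shows "b\<^sup>2 = 1"
proof (rule ccontr)
  assume b_ne: "b\<^sup>2 \<noteq> 1"
  obtain i1 i2 :: 'v where ne: "i2 \<noteq> i1" by (rule obtain_third)
  have "\<exists>D. moves D p (\<lambda>v. if s = Inl v then 1 else 0) (\<lambda>v. if s = Inr v then 1 else 0)" for s
    by (metis obtain_motion)
  then obtain \<Delta> where \<Delta>: "\<And>s. moves (\<Delta> s) p (\<lambda>v. if s = Inl v then 1 else 0) (\<lambda>v. if s = Inr v then 1 else 0)"
    by metis
  \<comment> \<open>Derivations inducing a given motion of \<open>p\<close> need not be unique;
    these are chosen linearly in \<open>r\<close>, so that their effect on \<open>b\<close> and
    \<open>q\<close> is linear too.\<close>
  define comb :: "real^('v + 'v) \<Rightarrow> real \<Rightarrow> real" where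
    "comb r x = (\<Sum>s\<in>UNIV. r $ s * \<Delta> s x)" for r x
  have comb: "moves (comb r) p (\<lambda>v. r $ Inl v) (\<lambda>v. r $ Inr v)" for r
  proof -
    have "derivation (comb r)"
      unfolding comb_def using \<Delta> by (intro derivation_linear_combination) (auto simp: moves_def)
    moreover have "\<Delta> s (p v $ 1) = - ((if s = Inl v then 1 else 0) * p v $ 2)"
      "\<Delta> s (p v $ 2) = (if s = Inl v then 1 else 0) * p v $ 1"
      "\<Delta> s (p v $ 3) = (if s = Inr v then 1 else 0)" for s v
      using \<Delta>[of s] unfolding moves_def by auto
    ultimately show ?thesis
      by (simp add: moves_def comb_def sum_negf if_distrib[of "\<lambda>x. _ * x"] if_distrib[of "\<lambda>x. x * _"]
          if_distrib[of uminus] cong: if_cong)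
  qed
  define rot where "rot r v = q v $ 1 * comb r (q v $ 2) - q v $ 2 * comb r (q v $ 1)" for r v
  have comb_q: "moves (comb r) q (rot r) (\<lambda>v. comb r (q v $ 3))" for r
    unfolding rot_def using moves_of_derivation[OF _ q, of "comb r"] comb[of r] by (simp add: moves_def)
  have lin: "comb (r + r') x = comb r x + comb r' x" "comb (k *\<^sub>R r) x = k * comb r x" for r r' k x
    by (simp_all add: comb_def algebra_simps sum.distrib sum_distrib_left)
  have rot_lin: "rot (r + r') v = rot r v + rot r' v" "rot (k *\<^sub>R r) v = k * rot r v" for r r' k v
    by (simp_all add: rot_def lin algebra_simps)
  \<comment> \<open>The slot \<open>i1\<close>, where the angular difference is trivial, carries the
    condition that \<open>b\<close> is constant. The last three entries exclude affine vertical
    motions and the common rotation.\<close>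
  define \<Phi> :: "real^('v + 'v) \<Rightarrow> (real^'v) \<times> real \<times> real \<times> real" where
    "\<Phi> r = (\<chi> i. if i = i1 then comb r b else rot r i - rot r i1, r $ Inr i1, r $ Inr i2, r $ Inl i1)" for r
  have "linear \<Phi>"
    by (intro linearI) (simp_all add: \<Phi>_def lin rot_lin vec_eq_iff algebra_simps)
  moreover have "DIM((real^'v) \<times> real \<times> real \<times> real) < DIM(real^('v + 'v))"
    using card_ge_4 by simp
  ultimately obtain r where r: "r \<noteq> 0" "\<Phi> r = 0"
    using linear_noninjective by blast
  have r_fst: "(if i = i1 then comb r b else rot r i - rot r i1) = 0" for i
    using r(2) by (simp add: \<Phi>_def zero_prod_def vec_eq_iff)
  have r_b: "comb r b = 0" using r_fst[of i1] by simp
  have r_rot: "rot r i = rot r i1" for i using r_fst[of i] by (cases "i = i1") auto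
  have r_fix: "r $ Inr i1 = 0" "r $ Inr i2 = 0" "r $ Inl i1 = 0"
    using r(2) by (simp_all add: \<Phi>_def zero_prod_def)
  have der: "derivation (comb r)" and comb_z: "\<And>v. comb r (p v $ 3) = r $ Inr v"
    using comb[of r] by (auto simp: moves_def)
  \<comment> \<open>At \<open>q\<close> only the vertical part of the strain remains, and it is b^2
    times that of \<open>p\<close>; subtracting it leaves the factor 1 - b^2.\<close>
  have flex: "strain p (\<lambda>v. r $ Inl v) (\<lambda>v. (1 - b\<^sup>2) * r $ Inr v) i j = 0" if "{i, j} \<in> E" for i j
  proof -
    have "comb r (q i $ 3) - comb r (q j $ 3) = b * (r $ Inr i - r $ Inr j)"
      by (simp add: b derivation_simps[OF der] r_b comb_z algebra_simps)
    moreover have "q i $ 3 - q j $ 3 = b * (p i $ 3 - p j $ 3)"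
      by (simp add: b algebra_simps)
    ultimately have "strain p (\<lambda>v. r $ Inl v) (\<lambda>v. r $ Inr v) i j
        = b\<^sup>2 * ((p i $ 3 - p j $ 3) * (r $ Inr i - r $ Inr j))"
      unfolding equivalent_frameworks_strain[OF eqv comb comb_q that]
      by (simp add: strain_def r_rot[of i] r_rot[of j] power2_eq_square)
    then show ?thesis by (simp add: strain_def algebra_simps)
  qed
  obtain D where "moves D p (\<lambda>v. r $ Inl v) (\<lambda>v. (1 - b\<^sup>2) * r $ Inr v)" by (rule obtain_motion)
  then obtain a' b' where ab: "\<And>v. (1 - b\<^sup>2) * r $ Inr v = a' + b' * p v $ 3"
    using flex_heights_affine[OF _ flex] by blast
  have "a' = 0 \<and> b' = 0"
    using affine_height_zero[OF ne, of a' b'] ab[of i1] ab[of i2] r_fix by simp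
  then have inr: "r $ Inr v = 0" for v using ab[of v] b_ne by simp
  \<comment> \<open>With no vertical part left, the flex can only be a common rotation, which is
    normalised to zero at \<open>i1\<close>.\<close>
  have "r $ Inl i = r $ Inl j" if "{i, j} \<in> E" for i j
    using flex[OF that] inr cross2_nonzero[of i j] by (cases "i = j") (auto simp: strain_def)
  then obtain a where "\<And>v. r $ Inl v = a" using edgewise_constant[of "\<lambda>v. r $ Inl v"] by auto
  then have inl: "r $ Inl v = 0" for v using r_fix by metis
  have "r = 0"
    unfolding vec_eq_iff
  proof
    fix s show "r $ s = 0 $ s" using inl inr by (cases s) auto
  qed
  then show False using r(1) by simp
qed

text \<open>Since b^2 = 1, vertical differences agree up to sign, so equal edge lengths give equal
  cosines.\<close>

lemma dot2_edge:
  assumes "{i, j} \<in> E" shows "dot2 q i j = dot2 p i j"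
proof -
  obtain a b where b: "\<And>i. q i $ 3 = a + b * p i $ 3" using heights_affine by blast
  have "(q i $ 3 - q j $ 3)\<^sup>2 = b\<^sup>2 * (p i $ 3 - p j $ 3)\<^sup>2"
    by (simp add: b power_mult_distrib[symmetric] algebra_simps)
  moreover have "dist (p i) (p j) = dist (q i) (q j)"
    using eqv assms by (simp add: equivalent_frameworks_def)
  ultimately show ?thesis
    using dist_squared_on_cylinder[OF cylinder, of i j] dist_squared_on_cylinder[OF q, of i j]
      height_scaling[OF b] by simp
qed

text \<open>The radial balance of \<open>p\<close> involves only cosines along edges, which
  \<open>q\<close> shares.\<close>

lemma radial_equilibrium: "(\<Sum>j\<in>UNIV. w i j * (1 - dot2 q i j)) + l i = 0"
proof -
  have n: "(p i $ 1)\<^sup>2 + (p i $ 2)\<^sup>2 = 1" by (rule on_cylinderD[OF cylinder])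
  have "(\<Sum>j\<in>UNIV. w i j * (1 - dot2 q i j)) = (\<Sum>j\<in>UNIV. w i j * (1 - dot2 p i j))"
    by (intro sum.cong refl) (use dot2_edge edge in fastforce)
  also have "\<dots> = p i $ 1 * (\<Sum>j\<in>UNIV. w i j * (p i $ 1 - p j $ 1)) + p i $ 2 * (\<Sum>j\<in>UNIV. w i j * (p i $ 2 - p j $ 2))"
    unfolding sum_distrib_left sum.distrib[symmetric]
  proof (intro sum.cong refl)
    fix j
    show "w i j * (1 - dot2 p i j) = p i $ 1 * (w i j * (p i $ 1 - p j $ 1)) + p i $ 2 * (w i j * (p i $ 2 - p j $ 2))"
      unfolding dot2_def using n by algebra
  qed
  also have "\<dots> = - l i"
    using n equilibrium_x[of i] equilibrium_y[of i] by algebra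
  finally show ?thesis by simp
qed

lemma horizontal_affine:
  "\<exists>a b. \<forall>i. q i $ 1 = a * p i $ 1 + b * p i $ 2" "\<exists>a b. \<forall>i. q i $ 2 = a * p i $ 1 + b * p i $ 2"
proof -
  have cross: "(\<Sum>j\<in>UNIV. w i j * cross2 q i j) = 0" for i
    using tangential_q by (simp add: tangential_equilibrium_def)
  \<comment> \<open>Radial and tangential components of the horizontal edge vector at
    \<open>q i\<close>; both are balanced, so the coordinates of \<open>q\<close> lie in the
    horizontal kernel.\<close>
  have decompose: "q i $ 1 - q j $ 1 = q i $ 1 * (1 - dot2 q i j) - q i $ 2 * cross2 q i j"
    "q i $ 2 - q j $ 2 = q i $ 2 * (1 - dot2 q i j) + q i $ 1 * cross2 q i j" for i j
    using on_cylinderD[OF q, of i] unfolding dot2_def cross2_def by algebra+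
  show "\<exists>a b. \<forall>i. q i $ 1 = a * p i $ 1 + b * p i $ 2"
  proof (rule horizontal_kernel)
    fix i
    have "(\<Sum>j\<in>UNIV. w i j * (q i $ 1 - q j $ 1)) + l i * q i $ 1
        = q i $ 1 * ((\<Sum>j\<in>UNIV. w i j * (1 - dot2 q i j)) + l i) - q i $ 2 * (\<Sum>j\<in>UNIV. w i j * cross2 q i j)"
      unfolding decompose[of i]
      by (simp add: algebra_simps sum.distrib sum_subtractf sum_distrib_left sum_distrib_right)
    then show "(\<Sum>j\<in>UNIV. w i j * (q i $ 1 - q j $ 1)) + l i * q i $ 1 = 0"
      unfolding radial_equilibrium cross by simp
  qed
  show "\<exists>a b. \<forall>i. q i $ 2 = a * p i $ 1 + b * p i $ 2"
  proof (rule horizontal_kernel)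
    fix i
    have "(\<Sum>j\<in>UNIV. w i j * (q i $ 2 - q j $ 2)) + l i * q i $ 2
        = q i $ 2 * ((\<Sum>j\<in>UNIV. w i j * (1 - dot2 q i j)) + l i) + q i $ 1 * (\<Sum>j\<in>UNIV. w i j * cross2 q i j)"
      unfolding decompose[of i]
      by (simp add: algebra_simps sum.distrib sum_subtractf sum_distrib_left sum_distrib_right)
    then show "(\<Sum>j\<in>UNIV. w i j * (q i $ 2 - q j $ 2)) + l i * q i $ 2 = 0"
      unfolding radial_equilibrium cross by simp
  qed
qed

text \<open>A linear map that preserves the norms of three pairwise independent vectors in the plane
  preserves their inner products.\<close>
lemma dot2_eq: "dot2 q i j = dot2 p i j"
proof (cases "i = j")
  case True
  then show ?thesis
    using on_cylinderD[OF cylinder, of i] on_cylinderD[OF q, of i]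
    by (simp add: dot2_def power2_eq_square)
next
  case False
  obtain k where k: "k \<noteq> i" "k \<noteq> j" by (rule obtain_third)
  obtain a b where x: "\<And>i. q i $ 1 = a * p i $ 1 + b * p i $ 2" using horizontal_affine(1) by blast
  obtain c d where y: "\<And>i. q i $ 2 = c * p i $ 1 + d * p i $ 2" using horizontal_affine(2) by blast
  let ?s = "cross2 p k j" and ?t = "cross2 p i k" and ?u = "cross2 p i j"
  \<comment> \<open>Cramer's rule for three plane vectors; the linear map carries the relation over
    to \<open>q\<close>.\<close>
  have px: "?u * p k $ 1 = ?s * p i $ 1 + ?t * p j $ 1" "?u * p k $ 2 = ?s * p i $ 2 + ?t * p j $ 2"
    unfolding cross2_def by algebra+
  then have qx: "?u * q k $ 1 = ?s * q i $ 1 + ?t * q j $ 1" "?u * q k $ 2 = ?s * q i $ 2 + ?t * q j $ 2"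
    unfolding x y by algebra+
  have norms: "(c v $ 1)\<^sup>2 + (c v $ 2)\<^sup>2 = 1" if "c = p \<or> c = q" for c v
    using that on_cylinderD[OF cylinder] on_cylinderD[OF q] by blast
  have "?u\<^sup>2 * ((c k $ 1)\<^sup>2 + (c k $ 2)\<^sup>2) =
      ?s\<^sup>2 * ((c i $ 1)\<^sup>2 + (c i $ 2)\<^sup>2) + ?t\<^sup>2 * ((c j $ 1)\<^sup>2 + (c j $ 2)\<^sup>2) + 2 * ?s * ?t * dot2 c i j"
    if "?u * c k $ 1 = ?s * c i $ 1 + ?t * c j $ 1" "?u * c k $ 2 = ?s * c i $ 2 + ?t * c j $ 2"
    for c :: "'v \<Rightarrow> real^3"
  proof -
    have "?u\<^sup>2 * ((c k $ 1)\<^sup>2 + (c k $ 2)\<^sup>2) = (?u * c k $ 1)\<^sup>2 + (?u * c k $ 2)\<^sup>2" by algebra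
    also have "\<dots> = (?s * c i $ 1 + ?t * c j $ 1)\<^sup>2 + (?s * c i $ 2 + ?t * c j $ 2)\<^sup>2"
      unfolding that ..
    finally show ?thesis unfolding dot2_def by algebra
  qed
  \<comment> \<open>All norms are 1, so the two expansions differ only in the mixed term.\<close>
  from this[OF px] this[OF qx] have "2 * ?s * ?t * dot2 p i j = 2 * ?s * ?t * dot2 q i j"
    by (simp add: norms)
  moreover have "2 * ?s * ?t \<noteq> 0"
    using cross2_nonzero[of k j] cross2_nonzero[of i k] k by simp
  ultimately show ?thesis by (metis mult_cancel_left)
qed

lemma congruent: "congruent_frameworks p q"
  unfolding congruent_frameworks_def
proof (intro allI)
  fix i j
  obtain a b where b: "\<And>i. q i $ 3 = a + b * p i $ 3" using heights_affine by blast
  have "(q i $ 3 - q j $ 3)\<^sup>2 = b\<^sup>2 * (p i $ 3 - p j $ 3)\<^sup>2"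
    by (simp add: b power_mult_distrib[symmetric] algebra_simps)
  then have "(dist (p i) (p j))\<^sup>2 = (dist (q i) (q j))\<^sup>2"
    unfolding dist_squared_on_cylinder[OF cylinder] dist_squared_on_cylinder[OF q]
    by (simp add: height_scaling[OF b] dot2_eq)
  then show "dist (p i) (p j) = dist (q i) (q j)" by simp
qed

end

section \<open>Kernel of the stress matrix\<close>

text \<open>The kernel is the orthogonal complement of the row space.\<close>

lemma dim_kernel_plus_rank:
  fixes A :: "real^'n^'m"
  shows "dim {x. A *v x = 0} + rank A = CARD('n)"
proof -
  have "{x. A *v x = 0} = {y \<in> UNIV. \<forall>x\<in>span (rows A). orthogonal x y}"
  proof -
    have "A *v y = 0 \<longleftrightarrow> (\<forall>x\<in>rows A. orthogonal y x)" for y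
      unfolding vec_eq_iff[of "A *v y"]
      by (auto simp: matrix_vector_mul_component rows_def row_def orthogonal_def inner_commute
          vec_lambda_eta)
    moreover have "(\<forall>x\<in>rows A. orthogonal y x) \<longleftrightarrow> (\<forall>x\<in>span (rows A). orthogonal y x)" for y
      using orthogonal_to_span[of _ "rows A" y] span_base by blast
    ultimately show ?thesis by (auto simp: orthogonal_commute)
  qed
  moreover have "dim {y \<in> UNIV. \<forall>x\<in>span (rows A). orthogonal x y} + dim (span (rows A)) = dim (UNIV :: (real^'n) set)"
    by (rule dim_subspace_orthogonal_to_vectors) auto
  ultimately show ?thesis by (simp add: row_rank_def)
qed

lemma stress_coeff_sym: "stress_coeff E \<omega> i j = stress_coeff E \<omega> j i"
  by (simp add: stress_coeff_def insert_commute)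

lemma stress_matrix_mult:
  assumes "simple_graph E"
  shows "(stress_matrix E \<omega> *v x) $ i = (\<Sum>j\<in>UNIV. stress_coeff E \<omega> i j * (x $ i - x $ j))"
proof -
  have loop: "stress_coeff E \<omega> i i = 0"
    using assms by (auto simp: stress_coeff_def simple_graph_def)
  have "(stress_matrix E \<omega> *v x) $ i =
      (\<Sum>j\<in>UNIV. (if i = j then (\<Sum>k\<in>UNIV. stress_coeff E \<omega> i k) * x $ i else 0) - stress_coeff E \<omega> i j * x $ j)"
    unfolding matrix_vector_mult_def stress_matrix_def by (auto simp: loop intro!: sum.cong)
  then show ?thesis
    by (simp add: sum_subtractf sum_distrib_right right_diff_distrib)
qed

lemma diag_matrix_mult: "(diag_matrix l *v x) $ i = l i * x $ i"
  by (simp add: matrix_vector_mult_def diag_matrix_def if_distrib[of "\<lambda>r. r * _"] cong: if_cong)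

lemma block_diag3_mult:
  "(block_diag3 A B C *v x) $ Inl i = (A *v (\<chi> j. x $ Inl j)) $ i"
  "(block_diag3 A B C *v x) $ Inr (Inl i) = (B *v (\<chi> j. x $ Inr (Inl j))) $ i"
  "(block_diag3 A B C *v x) $ Inr (Inr i) = (C *v (\<chi> j. x $ Inr (Inr j))) $ i"
  by (simp_all add: matrix_vector_mult_def block_diag3_def sum_UNIV_sum)

lemma equilibrium_stressD:
  assumes "equilibrium_stress E p \<omega> l"
  shows "(\<Sum>j\<in>UNIV. stress_coeff E \<omega> i j * (p i $ 1 - p j $ 1)) + l i * p i $ 1 = 0"
    and "(\<Sum>j\<in>UNIV. stress_coeff E \<omega> i j * (p i $ 2 - p j $ 2)) + l i * p i $ 2 = 0"
    and "(\<Sum>j\<in>UNIV. stress_coeff E \<omega> i j * (p i $ 3 - p j $ 3)) = 0"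
proof -
  have "((\<Sum>j\<in>UNIV. stress_coeff E \<omega> i j *\<^sub>R (p i - p j)) + l i *\<^sub>R horizontal (p i)) $ k = 0" for k
    using assms by (simp add: equilibrium_stress_def)
  from this[of 1] this[of 2] this[of 3] show
    "(\<Sum>j\<in>UNIV. stress_coeff E \<omega> i j * (p i $ 1 - p j $ 1)) + l i * p i $ 1 = 0"
    "(\<Sum>j\<in>UNIV. stress_coeff E \<omega> i j * (p i $ 2 - p j $ 2)) + l i * p i $ 2 = 0"
    "(\<Sum>j\<in>UNIV. stress_coeff E \<omega> i j * (p i $ 3 - p j $ 3)) = 0"
    by (simp_all add: horizontal_def)
qed

text \<open>The coordinate functions account for six dimensions of the kernel of the stress matrix,
  which are all when the rank is maximal.\<close>
lemma max_rank_kernel: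
  fixes p :: "'v::finite \<Rightarrow> real^3"
  assumes G: "simple_graph E" and p: "free_motion p" and eq: "equilibrium_stress E p \<omega> l"
    and rank: "maximum_rank_stress E \<omega> l" and card: "2 \<le> CARD('v)"
    and x: "cylinder_stress_matrix E \<omega> l *v x = 0"
  shows "\<exists>a b. \<forall>i. x $ Inl i = a * p i $ 1 + b * p i $ 2"
    and "\<exists>a b. \<forall>i. x $ Inr (Inr i) = a + b * p i $ 3"
proof -
  let ?C = "cylinder_stress_matrix E \<omega> l"
  let ?K = "{x. ?C *v x = 0}"
  define T :: "(real \<times> real) \<times> (real \<times> real) \<times> (real \<times> real) \<Rightarrow> real^('v + 'v + 'v)" where
    "T = (\<lambda>((a, b), (c, d), (e, f)). \<chi> s. case s of
        Inl i \<Rightarrow> a * p i $ 1 + b * p i $ 2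
      | Inr (Inl i) \<Rightarrow> c * p i $ 1 + d * p i $ 2
      | Inr (Inr i) \<Rightarrow> e + f * p i $ 3)"
  have T: "T ((a, b), (c, d), (e, f)) $ Inl i = a * p i $ 1 + b * p i $ 2"
    "T ((a, b), (c, d), (e, f)) $ Inr (Inl i) = c * p i $ 1 + d * p i $ 2"
    "T ((a, b), (c, d), (e, f)) $ Inr (Inr i) = e + f * p i $ 3" for a b c d e f i
    by (simp_all add: T_def)
  have lin: "linear T"
    by (intro linearI) (auto simp: T_def vec_eq_iff algebra_simps split: sum.split)
  obtain i j :: 'v where ij: "i \<noteq> j"
    using card by (metis (full_types) UNIV_I card_2_iff' card_le_Suc0_iff_eq finite_class.finite_UNIV not_less_eq_eq numeral_2_eq_2)
  have horizontal_zero: "a = 0 \<and> b = 0"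
    if "a * p i $ 1 + b * p i $ 2 = 0" "a * p j $ 1 + b * p j $ 2 = 0" for a b
  proof -
    have "a * cross2 p i j = 0" "b * cross2 p i j = 0"
      using that unfolding cross2_def by algebra+
    then show ?thesis using free_motion_cross2_nonzero[OF p ij] by simp
  qed
  have "c = 0" if zero: "T c = 0" for c
  proof -
    obtain a1 a2 b1 b2 c1 c2 where c: "c = ((a1, a2), (b1, b2), (c1, c2))" by (metis surj_pair)
    have coord: "T c $ s = 0" for s using zero by simp
    have "a1 = 0 \<and> a2 = 0"
      using coord[of "Inl i"] coord[of "Inl j"] unfolding c T by (rule horizontal_zero)
    moreover have "b1 = 0 \<and> b2 = 0"
      using coord[of "Inr (Inl i)"] coord[of "Inr (Inl j)"] unfolding c T by (rule horizontal_zero)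
    moreover have "c1 = 0 \<and> c2 = 0"
      using coord[of "Inr (Inr i)"] coord[of "Inr (Inr j)"] unfolding c T
      by (rule free_motion_affine_height_zero[OF p ij])
    ultimately show ?thesis by (simp add: c zero_prod_def)
  qed
  then have "inj T" using linear_injective_0[OF lin] by blast
  then have "dim (range T) = 6"
    using dim_image_eq[OF lin, of UNIV] by simp
  \<comment> \<open>The matrix has 3n columns and rank 3n - 6.\<close>
  moreover have "dim ?K = 6"
    using dim_kernel_plus_rank[of ?C] rank by (simp add: maximum_rank_stress_def)
  moreover have "range T \<subseteq> ?K"
  proof safe
    fix a1 a2 b1 b2 c1 c2
    have pull: "(\<Sum>j\<in>UNIV. stress_coeff E \<omega> i j * (a * f i + b * g i - (a * f j + b * g j)))
        = a * (\<Sum>j\<in>UNIV. stress_coeff E \<omega> i j * (f i - f j)) + b * (\<Sum>j\<in>UNIV. stress_coeff E \<omega> i j * (g i - g j))"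
      for i a b and f g :: "'v \<Rightarrow> real"
      by (simp add: algebra_simps sum.distrib sum_subtractf sum_distrib_left)
    have horizontal: "(\<Sum>j\<in>UNIV. stress_coeff E \<omega> i j * (a * p i $ 1 + b * p i $ 2 - (a * p j $ 1 + b * p j $ 2)))
        + l i * (a * p i $ 1 + b * p i $ 2) = 0" for i a b
      using equilibrium_stressD(1,2)[OF eq, of i]
      unfolding pull[of i a "\<lambda>i. p i $ 1" b "\<lambda>i. p i $ 2"] by algebra
    have vertical: "(\<Sum>j\<in>UNIV. stress_coeff E \<omega> i j * (a + b * p i $ 3 - (a + b * p j $ 3))) = 0" for i a b
      using equilibrium_stressD(3)[OF eq, of i] pull[of i a "\<lambda>i. 1" b "\<lambda>i. p i $ 3"] by simp
    have "(?C *v T ((a1, a2), (b1, b2), (c1, c2))) $ s = 0" for s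
      using horizontal vertical
      by (cases s rule: sum.exhaust; (cases "projr s" rule: sum.exhaust)?)
        (auto simp: cylinder_stress_matrix_def block_diag3_mult matrix_vector_mult_add_rdistrib
          stress_matrix_mult[OF G] diag_matrix_mult T)
    then show "?C *v T ((a1, a2), (b1, b2), (c1, c2)) = 0" by (simp add: vec_eq_iff)
  qed
  moreover have "subspace ?K" by (rule linear_subspace_kernel[OF matrix_vector_mul_linear])
  ultimately have range_T: "range T = ?K"
    using lin by (intro subspace_dim_equal) (auto intro: linear_subspace_image)
  have "x \<in> range T" unfolding range_T using x by simp
  then obtain y where y: "x = T y" ..
  obtain a b c d e f where "y = ((a, b), (c, d), (e, f))" by (metis surj_pair)
  with y show "\<exists>a b. \<forall>i. x $ Inl i = a * p i $ 1 + b * p i $ 2"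
    "\<exists>a b. \<forall>i. x $ Inr (Inr i) = a + b * p i $ 3"
    by (auto simp: T)
qed

text \<open>For two vertices the required rank is 0. Without an edge the zero stress attains it,
  although the distance of the two vertices can be changed freely; \<open>nondegenerate\<close>
  excludes this case.\<close>

theorem theorem8p2:
  fixes E :: "'v::finite set set"
    and p :: "'v \<Rightarrow> real^3"
    and \<omega> :: "'v set \<Rightarrow> real"
    and l :: "'v \<Rightarrow> real"
  assumes "simple_graph E"
    and "generic_on_cylinder p"
    and "equilibrium_stress E p \<omega> l"
    and "maximum_rank_stress E \<omega> l"
    and nondegenerate: "\<not> (CARD('v) = 2 \<and> E = {})"
  shows "globally_rigid_on_cylinder E p"
  unfolding globally_rigid_on_cylinder_def
proof (intro allI impI, elim conjE)
  fix q assume q: "on_cylinder q" and eqv: "equivalent_frameworks E p q"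
  have free: "free_motion p" by (rule generic_imp_free_motion[OF assms(2)])
  have "CARD('v) \<ge> 2" using assms(4) by (simp add: maximum_rank_stress_def)
  then consider "CARD('v) = 2" | "CARD('v) \<ge> 3" by linarith
  then show "congruent_frameworks p q"
  proof cases
    case 1
    then obtain e where e: "e \<in> E" using nondegenerate by blast
    then have "card e = 2" using assms(1) by (simp add: simple_graph_def)
    then have "e = UNIV" using 1 by (intro card_subset_eq) auto
    \<comment> \<open>The only pair of distinct vertices is the edge.\<close>
    then have "{u, v} = e" if "u \<noteq> v" for u v
      using 1 that by (intro card_subset_eq) auto
    then show ?thesis
      using e eqv unfolding congruent_frameworks_def equivalent_frameworks_def by (metis dist_self)
  next
    case 2
    note kernel = max_rank_kernel[OF assms(1) free assms(3,4) \<open>CARD('v) \<ge> 2\<close>]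
    note mult = cylinder_stress_matrix_def block_diag3_mult matrix_vector_mult_add_rdistrib
      stress_matrix_mult[OF assms(1)] diag_matrix_mult
    interpret equivalent_realisation E p "stress_coeff E \<omega>" l q
    proof
      fix f :: "'v \<Rightarrow> real"
      assume f: "\<And>i. (\<Sum>j\<in>UNIV. stress_coeff E \<omega> i j * (f i - f j)) = 0"
      \<comment> \<open>Padding \<open>f\<close> with zeros gives a kernel vector of the whole block
        matrix.\<close>
      let ?x = "\<chi> s. case s of Inl v \<Rightarrow> 0 | Inr (Inl v) \<Rightarrow> 0 | Inr (Inr v) \<Rightarrow> f v"
      have "(cylinder_stress_matrix E \<omega> l *v ?x) $ s = 0" for s
        by (cases s rule: sum.exhaust; (cases "projr s" rule: sum.exhaust)?) (auto simp: mult f)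
      then have "cylinder_stress_matrix E \<omega> l *v ?x = 0" by (simp add: vec_eq_iff)
      from kernel(2)[OF this] show "\<exists>a b. \<forall>i. f i = a + b * p i $ 3" by simp
    next
      fix f :: "'v \<Rightarrow> real"
      assume f: "\<And>i. (\<Sum>j\<in>UNIV. stress_coeff E \<omega> i j * (f i - f j)) + l i * f i = 0"
      let ?x = "\<chi> s. case s of Inl v \<Rightarrow> f v | Inr (Inl v) \<Rightarrow> 0 | Inr (Inr v) \<Rightarrow> 0"
      have "(cylinder_stress_matrix E \<omega> l *v ?x) $ s = 0" for s
        by (cases s rule: sum.exhaust; (cases "projr s" rule: sum.exhaust)?) (auto simp: mult f)
      then have "cylinder_stress_matrix E \<omega> l *v ?x = 0" by (simp add: vec_eq_iff)
      from kernel(1)[OF this] show "\<exists>a b. \<forall>i. f i = a * p i $ 1 + b * p i $ 2" by simp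
    next
      show "stress_coeff E \<omega> i j = stress_coeff E \<omega> j i" for i j by (rule stress_coeff_sym)
    qed (use free q eqv 2 equilibrium_stressD[OF assms(3)] in
        \<open>auto simp: stress_coeff_def\<close>)
    show ?thesis by (rule congruent)
  qed
qed

end
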